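(* Let $(M,g)=(M_1\times M_2,g_1\times g_2)$ be a special Einstein product. Suppose that $(M_1,g_1)$ has a linearly independent set $\{K_1,\dots,K_r\}$ of parallel tractors which each take values in $\mathcal{T}_1^\perp$. Then, via the identification of the standard tractor bundle and connection of $(M,[g])$ with $\mathcal{T}_1^\perp\oplus\mathcal{T}_2^\perp$, for each $i\in\{1,\dots,r\}$, $K_i$ determines the almost Einstein structure $\tilde K_i:=(K_i,0)$ on $(M,g)$, and this has scale singularity set $\Sigma(\tilde K_i)=\Sigma_{K_i}\times M_2$, where $\Sigma_{K_i}\subset M_1$ is the scale singularity set of $K_i$.
   Context: All manifolds are smooth and connected, all metrics Riemannian. Density bundles are trivialised by the metrics $g_1,g_2,g_1\times g_2$ respectively. Standard tractors of a conformal manifold $(M^d,c)$, $d\ge3$: $\mathcal{E}[w]$ denotes the line bundle whose sections are families $(f_g)_{g\in c}$ with $f_{e^{2\omega}g}=e^{w\omega}f_g$; $\mathbf{g}$ is the conformal metric (represented by $g$ in the scale $g$), used to raise and lower indices; the Schouten tensor $P$ is given by $\mathrm{Ric}=(d-2)P+Jg$, $J=\mathrm{tr}_gP$. Each $g\in c$ identifies the standard tractor bundle with $\mathcal{E}[1]\oplus T^*M[1]\oplus\mathcal{E}[-1]\ni(\sigma,\mu_a,\rho)$, with transformation under $\hat g=e^{2\omega}g$, $\Upsilon=d\omega$: $(\hat\sigma,\hat\mu_b,\hat\rho)=(\sigma,\mu_b+\sigma\Upsilon_b,\rho-\Upsilon^b\mu_b-\tfrac12\sigma\Upsilon^b\Upsilon_b)$.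 The tractor metric is $h(U,U)=2\sigma\rho+\mu^a\mu_a$, the normal tractor connection is $\nabla_a(\sigma,\mu^b,\rho)=(\nabla_a\sigma-\mu_a,\nabla_a\mu^b+\delta_a{}^b\rho+P_a{}^b\sigma,\nabla_a\rho-P_{ac}\mu^c)$, and the canonical tractor $X\in\mathcal{T}[1]$ satisfies $h(X,U)=\sigma$. A (directed) almost Einstein structure is a non-zero parallel tractor $K$; its scale singularity set $\Sigma_K$ is the zero set of $h(X,K)$. Tractors of an Einstein manifold $(N^m,g)$, $m\geq1$ (for $m=2$, Einstein means constant scalar curvature; for $m=1$ every metric is Einstein): trivialising densities by $g$, sections are triples $(s,t^a,r)$ of functions $s,r$ and a vector field $t$, with connection $$\nabla_a(s,t^b,r)=(\nabla_as-t_a,\ \nabla_at^b+\delta_a{}^b(r+\mu s),\ \nabla_ar-\mu t_a),$$ where $\mu=\mathrm{Sc}^g/(2m(m-1))$ if $m\ge2$, while for $m=1$ the number $\mu\in\mathbb{R}$ is part of the chosen data. For $m\geq3$ this agrees with the normal tractor connection above; for $m=1,2$ it is the definition. The metric is $2sr+g(t,t)$, the canonical tractor is $X=(0,0,1)$, and the scale singularity set of a parallel tractor $(s,t,r)$ is the zero set of $s$. The Einstein tractor is the parallel tractor $I=(1,0,-\mu)$, with $|I|^2=-2\mu$. A special Einstein product is a product $(M_1^{m_1}\times M_2^{m_2},g_1\times g_2)$ with $m_1,m_2\geq1$, $m_1+m_2\geq3$, where each $(M_i,g_i)$ is Einstein with tractor bundle $(\mathcal{T}_i,h_i,\nabla^i)$,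 Einstein tractor $I_i$, and $|I_1|^2=-|I_2|^2\neq0$. $\mathcal{T}_i^\perp$ is the orthogonal complement of $I_i$ in $\mathcal{T}_i$, pulled back to $M_1\times M_2$. For a special Einstein product the standard tractor bundle of $(M_1\times M_2,[g_1\times g_2])$, with its metric and connection, is identified with $\mathcal{T}_1^\perp\oplus\mathcal{T}_2^\perp$ with the restricted direct sum metric and connection, the canonical tractor being $X=(X_1^\perp,X_2^\perp)$, where $X_i^\perp$ is the orthogonal projection to $\mathcal{T}_i^\perp$ of the canonical tractor $X_i$ of $\mathcal{T}_i$. *)

theory Defs
  imports "HOL-Analysis.Analysis"
begin

section \<open>Smooth manifolds\<close>

text \<open>\<open>f\<close> is \<open>C\<^sup>k\<close> on \<open>S\<close>; only used for open \<open>S\<close>.\<close>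

primrec C_on :: "nat \<Rightarrow> 'e::euclidean_space set \<Rightarrow> ('e \<Rightarrow> 'v::real_normed_vector) \<Rightarrow> bool" where
  "C_on 0 S f \<longleftrightarrow> continuous_on S f"
| "C_on (Suc k) S f \<longleftrightarrow>
     (\<forall>x\<in>S. f differentiable (at x)) \<and>
     (\<forall>v. C_on k S (\<lambda>x. frechet_derivative f (at x) v))"

definition smooth_on :: "'e::euclidean_space set \<Rightarrow> ('e \<Rightarrow> 'v::real_normed_vector) \<Rightarrow> bool" where
  "smooth_on S f \<longleftrightarrow> (\<forall>k. C_on k S f)"

text \<open>
  The underlying space of a manifold is a whole type; a smooth structure is given by an indexed
  atlas (not required to be maximal, so that the products of charts form an atlas of a product).
  The dimension is that of the model space \<open>'e\<close>; it is at least \<open>1\<close>.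
\<close>

record ('a, 'e, 'i) atlas =
  charts :: "'i set"
  chart_dom :: "'i \<Rightarrow> 'a set"
  chart_map :: "'i \<Rightarrow> 'a \<Rightarrow> 'e"

definition chart_img :: "('a, 'e, 'i) atlas \<Rightarrow> 'i \<Rightarrow> 'e set" where
  "chart_img M i = chart_map M i ` chart_dom M i"

definition chart_inv :: "('a, 'e, 'i) atlas \<Rightarrow> 'i \<Rightarrow> 'e \<Rightarrow> 'a" where
  "chart_inv M i = inv_into (chart_dom M i) (chart_map M i)"

definition transition :: "('a, 'e, 'i) atlas \<Rightarrow> 'i \<Rightarrow> 'i \<Rightarrow> 'e \<Rightarrow> 'e" where
  "transition M i j = chart_map M j \<circ> chart_inv M i"

definition smooth_manifold ::
    "('a::{second_countable_topology, t2_space}, 'e::euclidean_space, 'i) atlas \<Rightarrow> bool" where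
  "smooth_manifold M \<longleftrightarrow>
     connected (UNIV :: 'a set) \<and>
     (\<Union>i\<in>charts M. chart_dom M i) = UNIV \<and>
     (\<forall>i\<in>charts M. open (chart_dom M i) \<and> open (chart_img M i) \<and>
        homeomorphism (chart_dom M i) (chart_img M i) (chart_map M i) (chart_inv M i)) \<and>
     (\<forall>i\<in>charts M. \<forall>j\<in>charts M.
        smooth_on (chart_map M i ` (chart_dom M i \<inter> chart_dom M j)) (transition M i j))"

definition prod_atlas ::
    "('a, 'e, 'i) atlas \<Rightarrow> ('b, 'f, 'j) atlas \<Rightarrow> ('a \<times> 'b, 'e \<times> 'f, 'i \<times> 'j) atlas" where
  "prod_atlas M N =
     \<lparr>charts = charts M \<times> charts N,
      chart_dom = (\<lambda>(i, j). chart_dom M i \<times> chart_dom N j),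
      chart_map = (\<lambda>(i, j) (p, q). (chart_map M i p, chart_map N j q))\<rparr>"

text \<open>
  Sections of bundles are given by their components in the charts, as functions of the chart index
  and the point; a tangent vector at \<open>p\<close> has components in \<open>'e\<close>. Values at a chart \<open>i\<close> outside
  \<open>charts M\<close>, or at points outside \<open>chart_dom M i\<close>, are irrelevant throughout.
\<close>

definition smooth_in_chart ::
    "('a, 'e::euclidean_space, 'i) atlas \<Rightarrow> 'i \<Rightarrow> ('a \<Rightarrow> 'v::real_normed_vector) \<Rightarrow> bool" where
  "smooth_in_chart M i f \<longleftrightarrow> smooth_on (chart_img M i) (\<lambda>x. f (chart_inv M i x))"

definition chart_deriv ::
    "('a, 'e::euclidean_space, 'i) atlas \<Rightarrow> 'i \<Rightarrow> ('a \<Rightarrow> 'v::real_normed_vector) \<Rightarrow> 'a \<Rightarrow> 'e \<Rightarrow> 'v" where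
  "chart_deriv M i f p u = frechet_derivative (\<lambda>x. f (chart_inv M i x)) (at (chart_map M i p)) u"

definition vector_transition ::
    "('a, 'e::euclidean_space, 'i) atlas \<Rightarrow> 'i \<Rightarrow> 'i \<Rightarrow> 'a \<Rightarrow> 'e \<Rightarrow> 'e" where
  "vector_transition M i j p = frechet_derivative (transition M i j) (at (chart_map M i p))"


section \<open>Riemannian metrics and curvature\<close>

type_synonym ('a, 'e, 'i) metric = "'i \<Rightarrow> 'a \<Rightarrow> 'e \<Rightarrow> 'e \<Rightarrow> real"

definition riemannian_metric ::
    "('a, 'e::euclidean_space, 'i) atlas \<Rightarrow> ('a, 'e, 'i) metric \<Rightarrow> bool" where
  "riemannian_metric M g \<longleftrightarrow>
     (\<forall>i\<in>charts M. \<forall>u v. smooth_in_chart M i (\<lambda>p. g i p u v)) \<and>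
     (\<forall>i\<in>charts M. \<forall>p\<in>chart_dom M i.
        bilinear (g i p) \<and> (\<forall>u v. g i p u v = g i p v u) \<and> (\<forall>u. u \<noteq> 0 \<longrightarrow> g i p u u > 0)) \<and>
     (\<forall>i\<in>charts M. \<forall>j\<in>charts M. \<forall>p\<in>chart_dom M i \<inter> chart_dom M j. \<forall>u v.
        g j p (vector_transition M i j p u) (vector_transition M i j p v) = g i p u v)"

definition metric_prod ::
    "('a, 'e, 'i) metric \<Rightarrow> ('b, 'f, 'j) metric \<Rightarrow> ('a \<times> 'b, 'e \<times> 'f, 'i \<times> 'j) metric" where
  "metric_prod g h = (\<lambda>(i, j) (p, q) (u1, u2) (v1, v2). g i p u1 v1 + h j q u2 v2)"

text \<open>The vector metrically dual to a covector.\<close>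

definition sharp :: "('e \<Rightarrow> 'e \<Rightarrow> real) \<Rightarrow> ('e \<Rightarrow> real) \<Rightarrow> 'e" where
  "sharp G \<alpha> = (THE z. \<forall>w. G z w = \<alpha> w)"

definition endo_trace :: "('e::euclidean_space \<Rightarrow> 'e) \<Rightarrow> real" where
  "endo_trace A = (\<Sum>b\<in>Basis. A b \<bullet> b)"

text \<open>The Levi-Civita connection in the chart \<open>i\<close> is \<open>\<nabla>\<^sub>u t = D\<^sub>u t + christoffel M g i p u t\<close>.\<close>

definition christoffel ::
    "('a, 'e::euclidean_space, 'i) atlas \<Rightarrow> ('a, 'e, 'i) metric \<Rightarrow> 'i \<Rightarrow> 'a \<Rightarrow> 'e \<Rightarrow> 'e \<Rightarrow> 'e" where
  "christoffel M g i p u v =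
     sharp (g i p) (\<lambda>w. (chart_deriv M i (\<lambda>q. g i q v w) p u + chart_deriv M i (\<lambda>q. g i q u w) p v
                          - chart_deriv M i (\<lambda>q. g i q u v) p w) / 2)"

text \<open>\<open>R(u, v)w = \<nabla>\<^sub>u\<nabla>\<^sub>v w - \<nabla>\<^sub>v\<nabla>\<^sub>u w - \<nabla>\<^bsub>[u,v]\<^esub> w\<close>, and \<open>Ric\<close> is positive on round spheres.\<close>

definition curvature ::
    "('a, 'e::euclidean_space, 'i) atlas \<Rightarrow> ('a, 'e, 'i) metric \<Rightarrow> 'i \<Rightarrow> 'a \<Rightarrow> 'e \<Rightarrow> 'e \<Rightarrow> 'e \<Rightarrow> 'e" where
  "curvature M g i p u v w =
     chart_deriv M i (\<lambda>q. christoffel M g i q v w) p u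
     - chart_deriv M i (\<lambda>q. christoffel M g i q u w) p v
     + christoffel M g i p u (christoffel M g i p v w)
     - christoffel M g i p v (christoffel M g i p u w)"

definition ricci ::
    "('a, 'e::euclidean_space, 'i) atlas \<Rightarrow> ('a, 'e, 'i) metric \<Rightarrow> 'i \<Rightarrow> 'a \<Rightarrow> 'e \<Rightarrow> 'e \<Rightarrow> real" where
  "ricci M g i p v w = endo_trace (\<lambda>u. curvature M g i p u v w)"

definition scalar_curvature ::
    "('a, 'e::euclidean_space, 'i) atlas \<Rightarrow> ('a, 'e, 'i) metric \<Rightarrow> 'i \<Rightarrow> 'a \<Rightarrow> real" where
  "scalar_curvature M g i p = endo_trace (\<lambda>u. sharp (g i p) (ricci M g i p u))"

text \<open>
  The trace of the defining equation \<open>Ric = (d - 2) P + J g\<close>, with \<open>J = tr P\<close>, gives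
  \<open>J = Sc / (2 (d - 1))\<close>.
\<close>

definition schouten ::
    "('a, 'e::euclidean_space, 'i) atlas \<Rightarrow> ('a, 'e, 'i) metric \<Rightarrow> 'i \<Rightarrow> 'a \<Rightarrow> 'e \<Rightarrow> 'e \<Rightarrow> real" where
  "schouten M g i p u v =
     (ricci M g i p u v - scalar_curvature M g i p / (2 * (real DIM('e) - 1)) * g i p u v)
       / (real DIM('e) - 2)"


section \<open>Tractors in a fixed scale\<close>

text \<open>
  Density bundles are trivialised by the metric \<open>g\<close>, so a tractor at a point is a triple
  \<open>(s, t, r)\<close> of a number, a tangent vector and a number, for the tractors of an
  Einstein manifold as well as for the standard tractors of \<open>(M, [g])\<close> (where the covector slot is
  raised with \<open>g\<close>). A tractor field consists of the components \<open>V i p\<close> of the triple in each chart.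
\<close>

type_synonym 'e tractor = "real \<times> 'e \<times> real"
type_synonym ('a, 'e, 'i) tractor_section = "'i \<Rightarrow> 'a \<Rightarrow> 'e tractor"

fun tractor_transition ::
    "('a, 'e::euclidean_space, 'i) atlas \<Rightarrow> 'i \<Rightarrow> 'i \<Rightarrow> 'a \<Rightarrow> 'e tractor \<Rightarrow> 'e tractor" where
  "tractor_transition M i j p (s, t, r) = (s, vector_transition M i j p t, r)"

definition tractor_field ::
    "('a, 'e::euclidean_space, 'i) atlas \<Rightarrow> ('a, 'e, 'i) tractor_section \<Rightarrow> bool" where
  "tractor_field M V \<longleftrightarrow>
     (\<forall>i\<in>charts M. smooth_in_chart M i (V i)) \<and>
     (\<forall>i\<in>charts M. \<forall>j\<in>charts M. \<forall>p\<in>chart_dom M i \<inter> chart_dom M j.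
        V j p = tractor_transition M i j p (V i p))"

fun tractor_metric :: "('e \<Rightarrow> 'e \<Rightarrow> real) \<Rightarrow> 'e tractor \<Rightarrow> 'e tractor \<Rightarrow> real" where
  "tractor_metric G (s, t, r) (s', t', r') = s * r' + s' * r + G t t'"

definition canonical_tractor :: "'e::zero tractor" where
  "canonical_tractor = (0, 0, 1)"

definition nonzero_section :: "('a, 'e, 'i) atlas \<Rightarrow> ('a, 'e::zero, 'i) tractor_section \<Rightarrow> bool" where
  "nonzero_section M V \<longleftrightarrow> (\<exists>i\<in>charts M. \<exists>p\<in>chart_dom M i. V i p \<noteq> 0)"

text \<open>Linear independence over \<open>\<real>\<close> of the sections \<open>K 1, \<dots>, K r\<close>.\<close>

definition independent_sections ::
    "('a, 'e, 'i) atlas \<Rightarrow> nat \<Rightarrow> (nat \<Rightarrow> ('a, 'e::real_vector, 'i) tractor_section) \<Rightarrow> bool" where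
  "independent_sections M r K \<longleftrightarrow>
     (\<forall>c :: nat \<Rightarrow> real.
        (\<forall>i\<in>charts M. \<forall>p\<in>chart_dom M i. (\<Sum>k\<in>{1..r}. c k *\<^sub>R K k i p) = 0) \<longrightarrow>
        (\<forall>k\<in>{1..r}. c k = 0))"

definition scale_singularity_set ::
    "('a, 'e::zero, 'i) atlas \<Rightarrow> ('a, 'e, 'i) metric \<Rightarrow> ('a, 'e, 'i) tractor_section \<Rightarrow> 'a set" where
  "scale_singularity_set M g V =
     {p. \<forall>i\<in>charts M. p \<in> chart_dom M i \<longrightarrow> tractor_metric (g i p) canonical_tractor (V i p) = 0}"


subsection \<open>Standard tractors of \<open>(M, [g])\<close>\<close>

fun normal_form ::
    "('a, 'e::euclidean_space, 'i) atlas \<Rightarrow> ('a, 'e, 'i) metric \<Rightarrow> 'i \<Rightarrow> 'a \<Rightarrow> 'e \<Rightarrow> 'e tractor \<Rightarrow> 'e tractor"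
where
  "normal_form M g i p u (s, t, r) =
     (- g i p u t,
      christoffel M g i p u t + r *\<^sub>R u + s *\<^sub>R sharp (g i p) (schouten M g i p u),
      - schouten M g i p u t)"

definition normal_tractor_connection ::
    "('a, 'e::euclidean_space, 'i) atlas \<Rightarrow> ('a, 'e, 'i) metric \<Rightarrow> ('a, 'e, 'i) tractor_section
      \<Rightarrow> 'i \<Rightarrow> 'a \<Rightarrow> 'e \<Rightarrow> 'e tractor" where
  "normal_tractor_connection M g V i p u = chart_deriv M i (V i) p u + normal_form M g i p u (V i p)"

definition almost_einstein_structure ::
    "('a, 'e::euclidean_space, 'i) atlas \<Rightarrow> ('a, 'e, 'i) metric \<Rightarrow> ('a, 'e, 'i) tractor_section \<Rightarrow> bool"
where
  "almost_einstein_structure M g V \<longleftrightarrow>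
     tractor_field M V \<and> nonzero_section M V \<and>
     (\<forall>i\<in>charts M. \<forall>p\<in>chart_dom M i. \<forall>u. normal_tractor_connection M g V i p u = 0)"


subsection \<open>Tractors of an Einstein manifold\<close>

text \<open>
  The number \<open>\<mu>\<close> is determined by the metric except in dimension \<open>1\<close>, where it is free.
\<close>

definition einstein_manifold ::
    "('a::{second_countable_topology, t2_space}, 'e::euclidean_space, 'i) atlas
      \<Rightarrow> ('a, 'e, 'i) metric \<Rightarrow> real \<Rightarrow> bool" where
  "einstein_manifold M g \<mu> \<longleftrightarrow>
     smooth_manifold M \<and> riemannian_metric M g \<and>
     (DIM('e) = 2 \<longrightarrow>
        (\<exists>\<kappa>::real. \<forall>i\<in>charts M. \<forall>p\<in>chart_dom M i. scalar_curvature M g i p = \<kappa>)) \<and>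
     (DIM('e) \<ge> 3 \<longrightarrow>
        (\<exists>\<kappa>::real. \<forall>i\<in>charts M. \<forall>p\<in>chart_dom M i. \<forall>u v. ricci M g i p u v = \<kappa> * g i p u v)) \<and>
     (DIM('e) \<ge> 2 \<longrightarrow>
        (\<forall>i\<in>charts M. \<forall>p\<in>chart_dom M i.
           \<mu> = scalar_curvature M g i p / (2 * real DIM('e) * (real DIM('e) - 1))))"

fun einstein_form ::
    "('a, 'e::euclidean_space, 'i) atlas \<Rightarrow> ('a, 'e, 'i) metric \<Rightarrow> real
      \<Rightarrow> 'i \<Rightarrow> 'a \<Rightarrow> 'e \<Rightarrow> 'e tractor \<Rightarrow> 'e tractor" where
  "einstein_form M g \<mu> i p u (s, t, r) =
     (- g i p u t, christoffel M g i p u t + (r + \<mu> * s) *\<^sub>R u, - \<mu> * g i p u t)"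

definition einstein_tractor_connection ::
    "('a, 'e::euclidean_space, 'i) atlas \<Rightarrow> ('a, 'e, 'i) metric \<Rightarrow> real \<Rightarrow> ('a, 'e, 'i) tractor_section
      \<Rightarrow> 'i \<Rightarrow> 'a \<Rightarrow> 'e \<Rightarrow> 'e tractor" where
  "einstein_tractor_connection M g \<mu> V i p u =
     chart_deriv M i (V i) p u + einstein_form M g \<mu> i p u (V i p)"

definition parallel_tractor ::
    "('a, 'e::euclidean_space, 'i) atlas \<Rightarrow> ('a, 'e, 'i) metric \<Rightarrow> real
      \<Rightarrow> ('a, 'e, 'i) tractor_section \<Rightarrow> bool" where
  "parallel_tractor M g \<mu> V \<longleftrightarrow>
     tractor_field M V \<and>
     (\<forall>i\<in>charts M. \<forall>p\<in>chart_dom M i. \<forall>u. einstein_tractor_connection M g \<mu> V i p u = 0)"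

definition einstein_tractor :: "real \<Rightarrow> 'e::zero tractor" where
  "einstein_tractor \<mu> = (1, 0, - \<mu>)"

definition tractor_perp :: "('e::zero \<Rightarrow> 'e \<Rightarrow> real) \<Rightarrow> real \<Rightarrow> 'e tractor set" where
  "tractor_perp G \<mu> = {v. tractor_metric G v (einstein_tractor \<mu>) = 0}"

definition perp_proj :: "('e::real_vector \<Rightarrow> 'e \<Rightarrow> real) \<Rightarrow> real \<Rightarrow> 'e tractor \<Rightarrow> 'e tractor" where
  "perp_proj G \<mu> v =
     v - (tractor_metric G v (einstein_tractor \<mu>)
          / tractor_metric G (einstein_tractor \<mu>) (einstein_tractor \<mu>)) *\<^sub>R einstein_tractor \<mu>"

definition perp_valued ::
    "('a, 'e::zero, 'i) atlas \<Rightarrow> ('a, 'e, 'i) metric \<Rightarrow> real \<Rightarrow> ('a, 'e, 'i) tractor_section \<Rightarrow> bool"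
where
  "perp_valued M g \<mu> V \<longleftrightarrow> (\<forall>i\<in>charts M. \<forall>p\<in>chart_dom M i. V i p \<in> tractor_perp (g i p) \<mu>)"


section \<open>Special Einstein products\<close>

definition special_einstein_product ::
    "('a::{second_countable_topology, t2_space}, 'e::euclidean_space, 'i) atlas
      \<Rightarrow> ('a, 'e, 'i) metric \<Rightarrow> real
      \<Rightarrow> ('b::{second_countable_topology, t2_space}, 'f::euclidean_space, 'j) atlas
      \<Rightarrow> ('b, 'f, 'j) metric \<Rightarrow> real \<Rightarrow> bool" where
  "special_einstein_product M1 g1 \<mu>1 M2 g2 \<mu>2 \<longleftrightarrow>
     einstein_manifold M1 g1 \<mu>1 \<and> einstein_manifold M2 g2 \<mu>2 \<and> DIM('e) + DIM('f) \<ge> 3 \<and>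
     (\<forall>i\<in>charts M1. \<forall>p\<in>chart_dom M1 i. \<forall>j\<in>charts M2. \<forall>q\<in>chart_dom M2 j.
        tractor_metric (g1 i p) (einstein_tractor \<mu>1) (einstein_tractor \<mu>1) =
          - tractor_metric (g2 j q) (einstein_tractor \<mu>2) (einstein_tractor \<mu>2) \<and>
        tractor_metric (g1 i p) (einstein_tractor \<mu>1) (einstein_tractor \<mu>1) \<noteq> 0)"

text \<open>
  Sections over \<open>M\<^sub>1 \<times> M\<^sub>2\<close> of the direct sum of the pulled back bundles
  \<open>\<T>\<^sub>1\<^sup>\<bottom> \<oplus> \<T>\<^sub>2\<^sup>\<bottom>\<close>. The components may depend on both points,
  and the transformation law makes the \<open>l\<close>-th component depend only on the chart of the
  \<open>l\<close>-th factor.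
\<close>

type_synonym ('a, 'e, 'i, 'b, 'f, 'j) sum_section =
  "'i \<times> 'j \<Rightarrow> 'a \<times> 'b \<Rightarrow> 'e tractor \<times> 'f tractor"

definition perp_sum_field ::
    "('a, 'e::euclidean_space, 'i) atlas \<Rightarrow> ('a, 'e, 'i) metric \<Rightarrow> real
      \<Rightarrow> ('b, 'f::euclidean_space, 'j) atlas \<Rightarrow> ('b, 'f, 'j) metric \<Rightarrow> real
      \<Rightarrow> ('a, 'e, 'i, 'b, 'f, 'j) sum_section \<Rightarrow> bool" where
  "perp_sum_field M1 g1 \<mu>1 M2 g2 \<mu>2 W \<longleftrightarrow>
     (\<forall>k\<in>charts (prod_atlas M1 M2). smooth_in_chart (prod_atlas M1 M2) k (W k)) \<and>
     (\<forall>i\<in>charts M1. \<forall>j\<in>charts M2. \<forall>p\<in>chart_dom M1 i. \<forall>q\<in>chart_dom M2 j.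
        W (i, j) (p, q) \<in> tractor_perp (g1 i p) \<mu>1 \<times> tractor_perp (g2 j q) \<mu>2) \<and>
     (\<forall>i\<in>charts M1. \<forall>i'\<in>charts M1. \<forall>j\<in>charts M2. \<forall>j'\<in>charts M2.
        \<forall>p\<in>chart_dom M1 i \<inter> chart_dom M1 i'. \<forall>q\<in>chart_dom M2 j \<inter> chart_dom M2 j'.
          W (i', j') (p, q) =
            (tractor_transition M1 i i' p (fst (W (i, j) (p, q))),
             tractor_transition M2 j j' q (snd (W (i, j) (p, q)))))"

text \<open>The direct sum of the two pulled back connections, in the direction \<open>(u\<^sub>1, u\<^sub>2)\<close>.\<close>

definition perp_sum_connection ::
    "('a, 'e::euclidean_space, 'i) atlas \<Rightarrow> ('a, 'e, 'i) metric \<Rightarrow> real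
      \<Rightarrow> ('b, 'f::euclidean_space, 'j) atlas \<Rightarrow> ('b, 'f, 'j) metric \<Rightarrow> real
      \<Rightarrow> ('a, 'e, 'i, 'b, 'f, 'j) sum_section
      \<Rightarrow> 'i \<times> 'j \<Rightarrow> 'a \<times> 'b \<Rightarrow> 'e \<times> 'f \<Rightarrow> 'e tractor \<times> 'f tractor" where
  "perp_sum_connection M1 g1 \<mu>1 M2 g2 \<mu>2 W = (\<lambda>(i, j) (p, q) (u1, u2).
     chart_deriv (prod_atlas M1 M2) (i, j) (W (i, j)) (p, q) (u1, u2)
     + (einstein_form M1 g1 \<mu>1 i p u1 (fst (W (i, j) (p, q))),
        einstein_form M2 g2 \<mu>2 j q u2 (snd (W (i, j) (p, q)))))"

text \<open>
  \<open>\<Phi>\<close> identifies \<open>\<T>\<^sub>1\<^sup>\<bottom> \<oplus> \<T>\<^sub>2\<^sup>\<bottom>\<close>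
  with the standard tractor bundle of the product (in the scale \<open>g\<^sub>1 \<times> g\<^sub>2\<close>):
  it is a smooth bundle isomorphism that matches metrics, canonical tractors
  and connections.
\<close>

definition product_tractor_identification ::
    "('a, 'e::euclidean_space, 'i) atlas \<Rightarrow> ('a, 'e, 'i) metric \<Rightarrow> real
      \<Rightarrow> ('b, 'f::euclidean_space, 'j) atlas \<Rightarrow> ('b, 'f, 'j) metric \<Rightarrow> real
      \<Rightarrow> ('i \<times> 'j \<Rightarrow> 'a \<times> 'b \<Rightarrow> 'e tractor \<times> 'f tractor \<Rightarrow> ('e \<times> 'f) tractor) \<Rightarrow> bool" where
  "product_tractor_identification M1 g1 \<mu>1 M2 g2 \<mu>2 \<Phi> \<longleftrightarrow>
     (\<forall>i\<in>charts M1. \<forall>j\<in>charts M2. \<forall>p\<in>chart_dom M1 i. \<forall>q\<in>chart_dom M2 j.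
        let F = \<Phi> (i, j) (p, q);
            E = tractor_perp (g1 i p) \<mu>1 \<times> tractor_perp (g2 j q) \<mu>2
        in bij_betw F E UNIV \<and>
           (\<forall>v\<in>E. \<forall>w\<in>E. F (v + w) = F v + F w) \<and>
           (\<forall>c. \<forall>v\<in>E. F (c *\<^sub>R v) = c *\<^sub>R F v) \<and>
           (\<forall>v\<in>E. \<forall>w\<in>E.
              tractor_metric (metric_prod g1 g2 (i, j) (p, q)) (F v) (F w) =
                tractor_metric (g1 i p) (fst v) (fst w) + tractor_metric (g2 j q) (snd v) (snd w)) \<and>
           F (perp_proj (g1 i p) \<mu>1 canonical_tractor, perp_proj (g2 j q) \<mu>2 canonical_tractor)
             = canonical_tractor) \<and>
     (\<forall>W. perp_sum_field M1 g1 \<mu>1 M2 g2 \<mu>2 W \<longrightarrow>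
        tractor_field (prod_atlas M1 M2) (\<lambda>k z. \<Phi> k z (W k z)) \<and>
        (\<forall>k\<in>charts (prod_atlas M1 M2). \<forall>z\<in>chart_dom (prod_atlas M1 M2) k. \<forall>u.
           normal_tractor_connection (prod_atlas M1 M2) (metric_prod g1 g2)
               (\<lambda>k z. \<Phi> k z (W k z)) k z u =
             \<Phi> k z (perp_sum_connection M1 g1 \<mu>1 M2 g2 \<mu>2 W k z u)))"

text \<open>
  The identification (unique, because \<open>X\<close> and its first two covariant derivatives span
  the standard tractor bundle). On \<open>\<T>\<^sub>l\<^sup>\<bottom>\<close> one has \<open>r\<^sub>l = \<mu>\<^sub>l s\<^sub>l\<close>; in the scale
  \<open>g\<^sub>1 \<times> g\<^sub>2\<close> the slots simply add up.
\<close>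

fun product_tractor_map :: "'e tractor \<times> 'f tractor \<Rightarrow> ('e \<times> 'f) tractor" where
  "product_tractor_map ((s1, t1, r1), (s2, t2, r2)) = (s1 + s2, (t1, t2), r1 + r2)"

text \<open>The section \<open>(K, 0)\<close> of \<open>\<T>\<^sub>1\<^sup>\<bottom> \<oplus> \<T>\<^sub>2\<^sup>\<bottom>\<close> and the standard tractor it corresponds to.\<close>

definition sum_inl ::
    "('a, 'e, 'i) tractor_section \<Rightarrow> ('a, 'e, 'i, 'b, 'f::zero, 'j) sum_section" where
  "sum_inl K = (\<lambda>(i, j) (p, q). (K i p, 0))"

definition induced_tractor ::
    "('a, 'e, 'i) tractor_section \<Rightarrow> ('a \<times> 'b, 'e \<times> 'f::zero, 'i \<times> 'j) tractor_section" where
  "induced_tractor K = (\<lambda>k z. product_tractor_map (sum_inl K k z))"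

end

theory Submission
  imports Defs
begin

text \<open>
  Let \<open>\<mu> = \<mu>\<^sub>1\<close>, so that \<open>|I\<^sub>1|\<^sup>2 = - |I\<^sub>2|\<^sup>2 \<noteq> 0\<close> says \<open>\<mu>\<^sub>2 = - \<mu> \<noteq> 0\<close>. The whole statement rests on one
  curvature identity: the Schouten tensor of the product is \<open>P = \<mu> g\<^sub>1 - \<mu> g\<^sub>2 = \<mu>\<^sub>1 g\<^sub>1 + \<mu>\<^sub>2 g\<^sub>2\<close>.
  Indeed both the Levi-Civita connection and the Ricci tensor of a product split, the factors have
  \<open>Ric\<^sub>l = 2 (m\<^sub>l - 1) \<mu>\<^sub>l g\<^sub>l\<close>, so \<open>Sc = 2 \<mu> (m\<^sub>1 - m\<^sub>2) (m\<^sub>1 + m\<^sub>2 - 1)\<close>, and the trace adjustment turns the two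
  different Einstein constants into the opposite numbers \<open>\<mu>\<close> and \<open>- \<mu>\<close>
  (\<open>schouten_prod_einstein\<close>).

  On \<open>\<T>\<^sub>l\<^sup>\<bottom>\<close> the last slot is \<open>r\<^sub>l = \<mu>\<^sub>l s\<^sub>l\<close>. Adding slots, \<open>(s\<^sub>1 + s\<^sub>2, (t\<^sub>1, t\<^sub>2), \<mu> (s\<^sub>1 - s\<^sub>2))\<close>, is therefore a
  bijection because \<open>\<mu> \<noteq> 0\<close>, and the cross terms \<open>s\<^sub>1 r\<^sub>2 + s\<^sub>2 r\<^sub>1\<close> of the tractor metric cancel because
  \<open>\<mu>\<^sub>2 = - \<mu>\<^sub>1\<close>. In the normal tractor connection the coefficient of \<open>u\<^sub>1\<close> in the middle slot is
  \<open>r\<^sub>1 + r\<^sub>2 + \<mu>\<^sub>1 (s\<^sub>1 + s\<^sub>2) = r\<^sub>1 + \<mu>\<^sub>1 s\<^sub>1\<close>, again by \<open>r\<^sub>2 = \<mu>\<^sub>2 s\<^sub>2 = - \<mu>\<^sub>1 s\<^sub>2\<close>, and likewise for \<open>u\<^sub>2\<close>: this is the sum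
  of the two Einstein connections (\<open>normal_form_prod\<close>). Once the identification is known, a parallel
  section \<open>K\<close> of \<open>\<T>\<^sub>1\<^sup>\<bottom>\<close> gives the parallel section \<open>(K, 0)\<close>; its top slot is the top slot of \<open>K\<close>, which
  determines the scale singularity set, and \<open>K \<noteq> 0\<close> by linear independence.

  Since everything is defined through charts, two analytic facts have to be supplied. The
  Christoffel symbols are dual vectors with respect to a metric that varies with the point, so the
  curvature is only meaningful once these duals are known to depend differentiably on the point
  (\<open>sharp_differentiable\<close>). And in dimension \<open>2\<close>, where Einstein only means constant scalar
  curvature, \<open>Ric = (Sc / 2) g\<close> needs the skewness of \<open>R(u, v)\<close> with respect to the metric, which comes
  from the symmetry of second derivatives (\<open>frechet_derivative_commute\<close>). In dimension \<open>1\<close> the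
  curvature vanishes by its skewness in the first two arguments, so that the formula for \<open>Ric\<close> holds
  for every choice of \<open>\<mu>\<close>.
\<close>

section \<open>Smooth functions on open sets\<close>

lemma C_on_cong:
  fixes f g :: "'e::euclidean_space \<Rightarrow> 'v::real_normed_vector"
  assumes "open S" "C_on k S f" "\<And>x. x \<in> S \<Longrightarrow> f x = g x"
  shows "C_on k S g"
  using assms(2,3)
proof (induction k arbitrary: f g)
  case 0
  then show ?case by (simp cong: continuous_on_cong)
next
  case (Suc k)
  have diff: "f differentiable (at x)" if "x \<in> S" for x
    using Suc.prems(1) that by simp
  have eq: "frechet_derivative f (at x) = frechet_derivative g (at x)" if "x \<in> S" for x
    using frechet_derivative_transform_within_open[OF diff[OF that] \<open>open S\<close> that] Suc.prems(2)
    by blast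
  have "g differentiable (at x)" if "x \<in> S" for x
    using diff[OF that] has_derivative_transform_within_open[OF _ \<open>open S\<close> that] Suc.prems(2)
    unfolding differentiable_def by blast
  moreover have "C_on k S (\<lambda>x. frechet_derivative g (at x) v)" for v
    using Suc.IH[of "\<lambda>x. frechet_derivative f (at x) v" "\<lambda>x. frechet_derivative g (at x) v"]
      Suc.prems(1) eq by simp
  ultimately show ?case by simp
qed

lemma C_on_bounded_linear_image:
  fixes f :: "'e::euclidean_space \<Rightarrow> 'v::real_normed_vector"
  assumes "open S" "bounded_linear L" "C_on k S f"
  shows "C_on k S (\<lambda>x. L (f x))"
  using assms(3)
proof (induction k arbitrary: f)
  case 0
  then show ?case
    using bounded_linear.continuous_on[OF assms(2)] by simp
next
  case (Suc k)
  have der: "((\<lambda>x. L (f x)) has_derivative (\<lambda>v. L (frechet_derivative f (at x) v))) (at x)"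
    if "x \<in> S" for x
    using Suc.prems that
    by (intro bounded_linear.has_derivative[OF assms(2)]) (simp add: frechet_derivative_works[symmetric])
  have "C_on k S (\<lambda>x. frechet_derivative (\<lambda>x. L (f x)) (at x) v)" for v
    by (rule C_on_cong[OF assms(1) Suc.IH[of "\<lambda>x. frechet_derivative f (at x) v"]])
       (use Suc.prems in simp, simp only: frechet_derivative_at[OF der, symmetric])
  with der show ?case by (auto simp: differentiable_def)
qed

text \<open>
  Used with the projections of a product, to regard functions on a factor as functions on
  the product.
\<close>

lemma C_on_bounded_linear_pullback:
  fixes f :: "'e::euclidean_space \<Rightarrow> 'v::real_normed_vector" and L :: "'d::euclidean_space \<Rightarrow> 'e"
  assumes "open T" "bounded_linear L" "L ` T \<subseteq> S" "C_on k S f"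
  shows "C_on k T (\<lambda>x. f (L x))"
  using assms(4)
proof (induction k arbitrary: f)
  case 0
  then show ?case
    using continuous_on_compose2[OF _ linear_continuous_on[OF assms(2)] assms(3)] by simp
next
  case (Suc k)
  have der: "((\<lambda>x. f (L x)) has_derivative (\<lambda>v. frechet_derivative f (at (L x)) (L v))) (at x)"
    if "x \<in> T" for x
  proof (rule has_derivative_compose[of L L _ _ f])
    show "(L has_derivative L) (at x)"
      using bounded_linear_imp_has_derivative[OF assms(2)] .
    show "(f has_derivative frechet_derivative f (at (L x))) (at (L x))"
      using Suc.prems that assms(3) by (auto simp: frechet_derivative_works[symmetric])
  qed
  have "C_on k T (\<lambda>x. frechet_derivative (\<lambda>x. f (L x)) (at x) v)" for v
    by (rule C_on_cong[OF assms(1) Suc.IH[of "\<lambda>x. frechet_derivative f (at x) (L v)"]])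
       (use Suc.prems in simp, simp only: frechet_derivative_at[OF der, symmetric])
  with der show ?case by (auto simp: differentiable_def)
qed

lemma C_on_add:
  fixes f g :: "'e::euclidean_space \<Rightarrow> 'v::real_normed_vector"
  assumes "open S" "C_on k S f" "C_on k S g"
  shows "C_on k S (\<lambda>x. f x + g x)"
  using assms(2,3)
proof (induction k arbitrary: f g)
  case 0
  then show ?case by (simp add: continuous_on_add)
next
  case (Suc k)
  have der: "((\<lambda>x. f x + g x) has_derivative
      (\<lambda>v. frechet_derivative f (at x) v + frechet_derivative g (at x) v)) (at x)" if "x \<in> S" for x
    using Suc.prems that by (intro has_derivative_add) (simp_all add: frechet_derivative_works[symmetric])
  have "C_on k S (\<lambda>x. frechet_derivative (\<lambda>x. f x + g x) (at x) v)" for v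
    by (rule C_on_cong[OF assms(1) Suc.IH[of "\<lambda>x. frechet_derivative f (at x) v"
            "\<lambda>x. frechet_derivative g (at x) v"]])
       (use Suc.prems in simp, use Suc.prems in simp,
        simp only: frechet_derivative_at[OF der, symmetric])
  with der show ?case by (auto simp: differentiable_def)
qed

lemma smooth_on_differentiable:
  assumes "smooth_on S f" "x \<in> S"
  shows "f differentiable (at x)"
  using assms by (metis C_on.simps(2) smooth_on_def)

lemma smooth_on_continuous:
  assumes "smooth_on S f"
  shows "continuous_on S f"
  using assms by (metis C_on.simps(1) smooth_on_def)

lemma smooth_on_frechet_derivative:
  assumes "smooth_on S f"
  shows "smooth_on S (\<lambda>x. frechet_derivative f (at x) v)"
  using assms by (metis C_on.simps(2) smooth_on_def)

text \<open>
  The mean value theorem is applied twice, first along \<open>u\<close> to the difference of \<open>f\<close> in the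
  direction \<open>v\<close>, then along \<open>v\<close> to the derivative of \<open>f\<close> in the direction \<open>u\<close>. The left-hand side of the
  resulting equation does not change when \<open>u\<close> and \<open>v\<close> are interchanged.
\<close>

lemma second_difference_mean_value:
  fixes f :: "'e::euclidean_space \<Rightarrow> real"
  assumes "h > 0"
    and inS: "\<And>s t. 0 \<le> s \<Longrightarrow> s \<le> h \<Longrightarrow> 0 \<le> t \<Longrightarrow> t \<le> h \<Longrightarrow> x + s *\<^sub>R u + t *\<^sub>R v \<in> S"
    and f: "\<And>y. y \<in> S \<Longrightarrow> f differentiable (at y)"
    and fu: "\<And>y. y \<in> S \<Longrightarrow> (\<lambda>y. frechet_derivative f (at y) u) differentiable (at y)"
  obtains s t where "0 \<le> s" "s \<le> h" "0 \<le> t" "t \<le> h"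
    "f (x + h *\<^sub>R u + h *\<^sub>R v) - f (x + h *\<^sub>R u) - f (x + h *\<^sub>R v) + f x =
       h\<^sup>2 * frechet_derivative (\<lambda>y. frechet_derivative f (at y) u) (at (x + s *\<^sub>R u + t *\<^sub>R v)) v"
proof -
  let ?D = "\<lambda>y. frechet_derivative f (at y) u"
  have lin: "(\<lambda>r. F (r *\<^sub>R w)) = (\<lambda>r. F w * r)"
    if "linear F" for F :: "'e \<Rightarrow> real" and w
    using linear_cmul[OF that] by (auto simp: mult.commute)
  have line: "((\<lambda>r. F (y + r *\<^sub>R w)) has_real_derivative frechet_derivative F (at (y + r *\<^sub>R w)) w) (at r)"
    if "F differentiable (at (y + r *\<^sub>R w))" for F :: "'e \<Rightarrow> real" and y w r
  proof -
    have "((\<lambda>r. F (y + r *\<^sub>R w)) has_derivative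
            (\<lambda>a. frechet_derivative F (at (y + r *\<^sub>R w)) (a *\<^sub>R w))) (at r)"
      by (rule has_derivative_compose[of "\<lambda>r. y + r *\<^sub>R w" _ _ _ F])
         (auto intro!: derivative_eq_intros simp: frechet_derivative_works[symmetric] that)
    then show ?thesis
      by (simp add: has_field_derivative_def lin linear_frechet_derivative[OF that])
  qed
  define \<phi> where "\<phi> s = f ((x + h *\<^sub>R v) + s *\<^sub>R u) - f (x + s *\<^sub>R u)" for s
  have d\<phi>: "(\<phi> has_real_derivative ?D ((x + h *\<^sub>R v) + s *\<^sub>R u) - ?D (x + s *\<^sub>R u)) (at s)"
    if "0 \<le> s" "s \<le> h" for s
    unfolding \<phi>_def
    using inS[of s h] inS[of s 0] that \<open>h > 0\<close>
    by (intro DERIV_diff line f) (auto simp: algebra_simps)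
  obtain s where s: "0 < s" "s < h"
    "\<phi> h - \<phi> 0 = (h - 0) * (?D ((x + h *\<^sub>R v) + s *\<^sub>R u) - ?D (x + s *\<^sub>R u))"
    using MVT2[OF \<open>h > 0\<close> d\<phi>] by auto
  define \<psi> where "\<psi> t = ?D ((x + s *\<^sub>R u) + t *\<^sub>R v)" for t
  have d\<psi>: "(\<psi> has_real_derivative frechet_derivative ?D (at ((x + s *\<^sub>R u) + t *\<^sub>R v)) v) (at t)"
    if "0 \<le> t" "t \<le> h" for t
    unfolding \<psi>_def using inS[of s t] that s by (intro line fu) auto
  obtain t where t: "0 < t" "t < h"
    "\<psi> h - \<psi> 0 = (h - 0) * frechet_derivative ?D (at ((x + s *\<^sub>R u) + t *\<^sub>R v)) v"
    using MVT2[OF \<open>h > 0\<close> d\<psi>] by auto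
  have "\<phi> h - \<phi> 0 = h * (\<psi> h - \<psi> 0)"
    using s(3) by (simp add: \<psi>_def algebra_simps)
  also have "\<dots> = h\<^sup>2 * frechet_derivative ?D (at (x + s *\<^sub>R u + t *\<^sub>R v)) v"
    using t(3) by (simp add: power2_eq_square)
  finally show thesis
    using s t by (intro that[of s t]) (auto simp: \<phi>_def algebra_simps)
qed

text \<open>
  Both mixed derivatives, taken at suitable points of an arbitrarily small parallelogram
  at \<open>x\<close>, equal the same second difference quotient; their continuity carries this over to \<open>x\<close>.
\<close>

lemma frechet_derivative_commute:
  fixes f :: "'e::euclidean_space \<Rightarrow> real"
  assumes "open S" "x \<in> S" and smooth: "smooth_on S f"
  shows "frechet_derivative (\<lambda>y. frechet_derivative f (at y) u) (at x) v =
         frechet_derivative (\<lambda>y. frechet_derivative f (at y) v) (at x) u"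
proof -
  define D where "D a b y = frechet_derivative (\<lambda>y. frechet_derivative f (at y) a) (at y) b" for a b y
  have cont: "continuous_on S (D a b)" for a b
    unfolding D_def by (intro smooth_on_continuous smooth_on_frechet_derivative smooth)
  have "\<bar>D u v x - D v u x\<bar> \<le> e" if "e > 0" for e
  proof -
    have "\<exists>d>0. \<forall>y. dist y x < d \<longrightarrow> y \<in> S \<and> dist (D a b y) (D a b x) < e / 2" for a b
    proof -
      have "isCont (D a b) x"
        using cont assms(1,2) continuous_on_eq_continuous_at by blast
      then have "\<forall>\<^sub>F y in nhds x. dist (D a b y) (D a b x) < e / 2"
        using \<open>e > 0\<close> by (metis half_gt_zero isCont_def tendstoD tendsto_at_iff_tendsto_nhds)
      moreover have "\<forall>\<^sub>F y in nhds x. y \<in> S"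
        using assms(1,2) eventually_nhds by blast
      ultimately have "\<forall>\<^sub>F y in nhds x. y \<in> S \<and> dist (D a b y) (D a b x) < e / 2"
        by eventually_elim auto
      then show ?thesis
        by (simp add: eventually_nhds_metric)
    qed
    from this[of u v] this[of v u] obtain d d' where d: "d > 0" "d' > 0"
      "\<And>y. dist y x < d \<Longrightarrow> y \<in> S \<and> dist (D u v y) (D u v x) < e / 2"
      "\<And>y. dist y x < d' \<Longrightarrow> y \<in> S \<and> dist (D v u y) (D v u x) < e / 2"
      by metis
    \<comment> \<open>The parallelogram with sides \<open>h u\<close>, \<open>h v\<close> stays within the distance \<open>min d d' / 2\<close> of \<open>x\<close>.\<close>
    define h where "h = min d d' / (2 * (norm u + norm v + 1))"
    have pos: "norm u + norm v + 1 > 0"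
      by (simp add: add_nonneg_pos)
    have "h > 0"
      using d pos by (simp add: h_def)
    have small: "dist (x + s *\<^sub>R u + t *\<^sub>R v) x < d \<and> dist (x + s *\<^sub>R u + t *\<^sub>R v) x < d'"
      if "0 \<le> s" "s \<le> h" "0 \<le> t" "t \<le> h" for s t
    proof -
      have "dist (x + s *\<^sub>R u + t *\<^sub>R v) x = norm (s *\<^sub>R u + t *\<^sub>R v)"
        by (simp add: dist_norm algebra_simps)
      also have "\<dots> \<le> s * norm u + t * norm v"
        using norm_triangle_ineq[of "s *\<^sub>R u" "t *\<^sub>R v"] that by simp
      also have "\<dots> \<le> h * norm u + h * norm v"
        using that by (intro add_mono mult_right_mono) auto
      also have "\<dots> \<le> h * (norm u + norm v + 1)"
        using \<open>h > 0\<close> by (simp add: algebra_simps)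
      also have "\<dots> = min d d' / 2"
      proof -
        have "a / (2 * b) * b = a / 2" if "b > 0" for a b :: real
          using that by simp
        from this[OF pos] show ?thesis by (simp only: h_def)
      qed
      finally show ?thesis using d by auto
    qed
    have inS: "x + s *\<^sub>R u + t *\<^sub>R v \<in> S" if "0 \<le> s" "s \<le> h" "0 \<le> t" "t \<le> h" for s t
      using small[OF that] d(3) by blast
    have diff: "f differentiable (at y)" "(\<lambda>y. frechet_derivative f (at y) a) differentiable (at y)"
      if "y \<in> S" for y a
      using that smooth smooth_on_differentiable smooth_on_frechet_derivative by blast+
    obtain s t where st: "0 \<le> s" "s \<le> h" "0 \<le> t" "t \<le> h"
      "f (x + h *\<^sub>R u + h *\<^sub>R v) - f (x + h *\<^sub>R u) - f (x + h *\<^sub>R v) + f x =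
         h\<^sup>2 * D u v (x + s *\<^sub>R u + t *\<^sub>R v)"
      using second_difference_mean_value[OF \<open>h > 0\<close> inS diff(1) diff(2)[of _ u]]
      unfolding D_def by blast
    have inS': "x + s *\<^sub>R v + t *\<^sub>R u \<in> S" if "0 \<le> s" "s \<le> h" "0 \<le> t" "t \<le> h" for s t
    proof -
      have "x + s *\<^sub>R v + t *\<^sub>R u = x + t *\<^sub>R u + s *\<^sub>R v"
        by simp
      with inS[of t s] that show ?thesis by (simp only: )
    qed
    obtain s' t' where st': "0 \<le> s'" "s' \<le> h" "0 \<le> t'" "t' \<le> h"
      "f (x + h *\<^sub>R v + h *\<^sub>R u) - f (x + h *\<^sub>R v) - f (x + h *\<^sub>R u) + f x =
         h\<^sup>2 * D v u (x + s' *\<^sub>R v + t' *\<^sub>R u)"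
      using second_difference_mean_value[OF \<open>h > 0\<close> inS' diff(1) diff(2)[of _ v]]
      unfolding D_def by blast
    have "h\<^sup>2 * D u v (x + s *\<^sub>R u + t *\<^sub>R v) = h\<^sup>2 * D v u (x + s' *\<^sub>R v + t' *\<^sub>R u)"
      using st(5) st'(5) by (simp add: algebra_simps)
    then have "D u v (x + s *\<^sub>R u + t *\<^sub>R v) = D v u (x + t' *\<^sub>R u + s' *\<^sub>R v)"
      using \<open>h > 0\<close> by (simp add: algebra_simps)
    moreover have "dist (D u v (x + s *\<^sub>R u + t *\<^sub>R v)) (D u v x) < e / 2"
      using d(3) small st by blast
    moreover have "dist (D v u (x + t' *\<^sub>R u + s' *\<^sub>R v)) (D v u x) < e / 2"
      using d(4) small st' by blast
    ultimately show ?thesis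
      unfolding dist_real_def by linarith
  qed
  then have "\<bar>D u v x - D v u x\<bar> \<le> 0"
    by (rule field_le_epsilon) auto
  then show ?thesis
    by (simp add: D_def)
qed

section \<open>Dual vectors of inner products\<close>

definition inner_form :: "('e::euclidean_space \<Rightarrow> 'e \<Rightarrow> real) \<Rightarrow> bool" where
  "inner_form G \<longleftrightarrow> bilinear G \<and> (\<forall>u v. G u v = G v u) \<and> (\<forall>u. u \<noteq> 0 \<longrightarrow> G u u > 0)"

lemma linear_sum_Basis:
  fixes f :: "'e::euclidean_space \<Rightarrow> 'v::real_vector"
  assumes "linear f"
  shows "f a = (\<Sum>b\<in>Basis. (a \<bullet> b) *\<^sub>R f b)"
proof -
  have "f a = f (\<Sum>b\<in>Basis. (a \<bullet> b) *\<^sub>R b)"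
    by (simp add: euclidean_representation)
  also have "\<dots> = (\<Sum>b\<in>Basis. (a \<bullet> b) *\<^sub>R f b)"
    using assms by (simp add: linear_sum linear_cmul)
  finally show ?thesis .
qed

lemma inner_form_linear:
  assumes "inner_form G"
  shows "linear (G u)" "linear (\<lambda>u. G u v)"
  using assms by (auto simp: inner_form_def bilinear_def)

lemma inner_form_nondegenerate:
  assumes G: "inner_form G" and eq: "\<And>w. G a w = G b w"
  shows "a = b"
proof (rule ccontr)
  assume "a \<noteq> b"
  then have "G (a - b) (a - b) > 0"
    using G by (simp add: inner_form_def)
  moreover have "G (a - b) (a - b) = G a (a - b) - G b (a - b)"
    using linear_diff[OF inner_form_linear(2)[OF G]] by simp
  ultimately show False using eq by simp
qed

lemma sharp_eqI:
  assumes "inner_form G" "\<And>w. G z w = \<alpha> w"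
  shows "sharp G \<alpha> = z"
  unfolding sharp_def using assms inner_form_nondegenerate[of G] by (intro the_equality) auto

text \<open>The vector that represents the form \<open>G z\<close> with respect to the standard inner product.\<close>

definition gram :: "('e::euclidean_space \<Rightarrow> 'e \<Rightarrow> real) \<Rightarrow> 'e \<Rightarrow> 'e" where
  "gram G z = (\<Sum>b\<in>Basis. G z b *\<^sub>R b)"

lemma gram_inner:
  assumes "linear (G z)"
  shows "gram G z \<bullet> w = G z w"
  by (subst linear_sum_Basis[OF assms])
     (simp add: gram_def inner_sum_left, simp add: inner_commute mult.commute)

lemma linear_gram:
  assumes "inner_form G"
  shows "linear (gram G)"
proof -
  have *: "linear (\<lambda>z. G z b)" for b
    using assms by (rule inner_form_linear)
  show ?thesis
    by (rule linearI)
       (simp_all add: gram_def linear_add[OF *] linear_cmul[OF *] sum.distrib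
          scaleR_left_distrib scaleR_sum_right)
qed

lemma inj_gram:
  assumes "inner_form G"
  shows "inj (gram G)"
proof (rule injI)
  fix a b assume "gram G a = gram G b"
  then show "a = b"
    using inner_form_nondegenerate[OF assms] gram_inner inner_form_linear(1)[OF assms] by metis
qed

text \<open>
  Existence of the dual vector: the Gram map of a nondegenerate form is injective, and in
  finite dimension this makes it surjective.
\<close>

lemma sharp_works:
  assumes G: "inner_form G" and \<alpha>: "linear \<alpha>"
  shows "G (sharp G \<alpha>) w = \<alpha> w"
proof -
  have "surj (gram G)"
    by (rule eucl.linear_inj_imp_surj[OF linear_gram[OF G] inj_gram[OF G]])
  then obtain z where z: "gram G z = (\<Sum>b\<in>Basis. \<alpha> b *\<^sub>R b)"
    by (metis surjD)
  have "G z w = \<alpha> w" for w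
  proof -
    have "G z w = (\<Sum>b\<in>Basis. \<alpha> b *\<^sub>R b) \<bullet> w"
      using gram_inner[where G = G and z = z and w = w, OF inner_form_linear(1)[OF G]] z by simp
    also have "\<dots> = \<alpha> w"
      by (subst linear_sum_Basis[OF \<alpha>]) (simp add: inner_sum_left, simp add: inner_commute mult.commute)
    finally show ?thesis .
  qed
  with sharp_eqI[OF G this] show ?thesis by simp
qed

lemma gram_sharp:
  assumes "inner_form G" "linear \<alpha>"
  shows "gram G (sharp G \<alpha>) = (\<Sum>b\<in>Basis. \<alpha> b *\<^sub>R b)"
  using sharp_works[OF assms] by (simp add: gram_def)

text \<open>
  A domination principle: it turns the derivative of an explicit residual into the
  derivative of the error of an approximate solution.
\<close>

lemma has_derivative_zero_bound:
  fixes e :: "'a::real_normed_vector \<Rightarrow> 'b::real_normed_vector" and r :: "'a \<Rightarrow> 'c::real_normed_vector"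
  assumes r: "(r has_derivative (\<lambda>h. 0)) (at x)" "r x = 0" "e x = 0"
    and bound: "\<forall>\<^sub>F y in at x. norm (e y) \<le> C * norm (r y)"
  shows "(e has_derivative (\<lambda>h. 0)) (at x)"
proof -
  have "((\<lambda>y. C * (norm (r y) / norm (y - x))) \<longlongrightarrow> C * 0) (at x)"
    using r(1,2) by (intro tendsto_mult_left) (simp add: has_derivative_iff_norm)
  then have lim: "((\<lambda>y. C * (norm (r y) / norm (y - x))) \<longlongrightarrow> 0) (at x)"
    by simp
  have "((\<lambda>y. norm (e y) / norm (y - x)) \<longlongrightarrow> 0) (at x)"
  proof (rule tendsto_sandwich[OF _ _ tendsto_const lim])
    show "\<forall>\<^sub>F y in at x. norm (e y) / norm (y - x) \<le> C * (norm (r y) / norm (y - x))"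
      using bound by eventually_elim (simp add: divide_right_mono)
  qed simp
  with r(3) show ?thesis
    by (simp add: has_derivative_iff_norm)
qed

text \<open>
  A lower bound for the Gram map at \<open>x\<close> persists nearby, with half the constant, because the
  operator norm of the difference is bounded by its finitely many values on the basis, and these
  are continuous. This replaces the continuity of matrix inversion.
\<close>

lemma gram_bounded_below:
  fixes G :: "'x::t2_space \<Rightarrow> 'e::euclidean_space \<Rightarrow> 'e \<Rightarrow> real"
  assumes "inner_form (G x)" and "\<forall>\<^sub>F y in at x. inner_form (G y)"
    and cont: "\<And>u v. isCont (\<lambda>y. G y u v) x"
  obtains B where "B > 0" "\<forall>\<^sub>F y in at x. \<forall>z. B * norm z \<le> norm (gram (G y) z)"
proof -
  obtain B where B: "B > 0" "\<And>z. B * norm z \<le> norm (gram (G x) z)"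
    using linear_inj_bounded_below_pos[OF linear_gram inj_gram] assms(1) by metis
  define d where "d y = (\<Sum>a\<in>Basis. norm (gram (G y) a - gram (G x) a))" for y
  have "((\<lambda>y. d y) \<longlongrightarrow> 0) (at x)"
  proof -
    have "((\<lambda>y. gram (G y) a) \<longlongrightarrow> gram (G x) a) (at x)" for a
      unfolding gram_def using cont by (intro tendsto_intros) (simp add: isCont_def)
    then have "((\<lambda>y. norm (gram (G y) a - gram (G x) a)) \<longlongrightarrow> 0) (at x)" for a
      by (metis LIM_zero tendsto_norm_zero)
    then show ?thesis
      unfolding d_def by (rule tendsto_null_sum)
  qed
  then have "\<forall>\<^sub>F y in at x. d y < B / 2"
    using B(1) by (metis half_gt_zero order_tendstoD(2))
  then have "\<forall>\<^sub>F y in at x. \<forall>z. B / 2 * norm z \<le> norm (gram (G y) z)"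
    using assms(2)
  proof eventually_elim
    case (elim y)
    show ?case
    proof
      fix z
      have lin: "linear (\<lambda>z. gram (G y) z - gram (G x) z)"
        using linear_gram assms(1) elim(2) by (intro linear_compose_sub) auto
      have "norm (gram (G y) z - gram (G x) z) =
          norm (\<Sum>a\<in>Basis. (z \<bullet> a) *\<^sub>R (gram (G y) a - gram (G x) a))"
        by (subst linear_sum_Basis[OF lin]) simp
      also have "\<dots> \<le> (\<Sum>a\<in>Basis. norm z * norm (gram (G y) a - gram (G x) a))"
        by (rule sum_norm_le) (auto intro!: mult_right_mono simp: Basis_le_norm)
      also have "\<dots> = norm z * d y"
        by (simp add: d_def sum_distrib_left)
      also have "\<dots> \<le> norm z * (B / 2)"
        using elim(1) by (intro mult_left_mono) auto
      finally have "norm (gram (G y) z - gram (G x) z) \<le> B / 2 * norm z"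
        by (simp add: mult.commute)
      moreover have "norm (gram (G x) z) \<le> norm (gram (G y) z) + norm (gram (G y) z - gram (G x) z)"
        by (metis norm_minus_commute norm_triangle_sub)
      ultimately show "B / 2 * norm z \<le> norm (gram (G y) z)"
        using B(2)[of z] by linarith
    qed
  qed
  with B(1) show thesis by (intro that[of "B / 2"]) auto
qed

text \<open>
  The dual vector \<open>z\<close> solves \<open>gram (G y) (z y) = a y\<close>. Formal differentiation of this equation
  gives the only possible derivative \<open>z'\<close> of \<open>z\<close> at \<open>x\<close>. The error \<open>e\<close> of the corresponding linear
  approximation solves the same kind of equation with a residual \<open>r\<close> that is differentiable with
  derivative \<open>0\<close>, and the lower bound on the Gram maps controls \<open>e\<close> by \<open>r\<close>.
\<close>

lemma sharp_differentiable:
  fixes G :: "'x::euclidean_space \<Rightarrow> 'e::euclidean_space \<Rightarrow> 'e \<Rightarrow> real"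
  assumes "open S" "x \<in> S"
    and G: "\<And>y. y \<in> S \<Longrightarrow> inner_form (G y)" and \<alpha>: "\<And>y. y \<in> S \<Longrightarrow> linear (\<alpha> y)"
    and dG: "\<And>u v. (\<lambda>y. G y u v) differentiable (at x)"
    and d\<alpha>: "\<And>w. (\<lambda>y. \<alpha> y w) differentiable (at x)"
  shows "(\<lambda>y. sharp (G y) (\<alpha> y)) differentiable (at x)"
proof -
  define z where "z y = sharp (G y) (\<alpha> y)" for y
  define a where "a y = (\<Sum>b\<in>Basis. \<alpha> y b *\<^sub>R b)" for y
  have eq: "gram (G y) (z y) = a y" if "y \<in> S" for y
    using gram_sharp[OF G \<alpha>] that by (simp add: z_def a_def)
  have inS: "\<forall>\<^sub>F y in at x. y \<in> S"
    using assms(1,2) eventually_at_topological by blast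
  have "a differentiable (at x)"
    unfolding a_def using d\<alpha> by (intro differentiable_sum) auto
  then obtain a' where a': "(a has_derivative a') (at x)"
    by (auto simp: differentiable_def)
  have "(\<lambda>y. gram (G y) (z x)) differentiable (at x)"
    unfolding gram_def using dG by (intro differentiable_sum) auto
  then obtain A' where A': "((\<lambda>y. gram (G y) (z x)) has_derivative A') (at x)"
    by (auto simp: differentiable_def)
  have surj: "surj (gram (G x))"
    using eucl.linear_inj_imp_surj linear_gram inj_gram G assms(2) by blast
  obtain L where L: "linear L" "\<And>y. gram (G x) (L y) = y"
    using linear_surjective_right_inverse[OF linear_gram[OF G[OF assms(2)]] surj]
    by (auto simp: fun_eq_iff)
  \<comment> \<open>Differentiating \<open>gram (G y) (z y) = a y\<close> at \<open>x\<close> gives \<open>A' h + gram (G x) (z' h) = a' h\<close>.\<close>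
  define z' where "z' h = L (a' h - A' h)" for h
  have "bounded_linear z'"
    unfolding z'_def
    by (rule bounded_linear_compose[OF linear_conv_bounded_linear[THEN iffD1, OF L(1)]
          bounded_linear_sub[OF has_derivative_bounded_linear[OF a']
            has_derivative_bounded_linear[OF A']]])
  then have z': "linear z'"
    by (simp add: bounded_linear.linear)
  define r where "r y = a y - gram (G y) (z x) - gram (G y) (z' (y - x))" for y
  have "(r has_derivative (\<lambda>h. 0)) (at x)"
  proof -
    have gr: "((\<lambda>y. gram (G y) (z' (y - x))) has_derivative (\<lambda>h. gram (G x) (z' h))) (at x)"
    proof -
      have expand: "gram (G y) (z' (y - x)) =
          (\<Sum>b\<in>Basis. (z' (y - x) \<bullet> b) *\<^sub>R gram (G y) b)" if "y \<in> S" for y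
        using linear_sum_Basis[OF linear_gram[OF G[OF that]]] .
      have d: "(\<lambda>y. gram (G y) b) differentiable (at x)" for b
        unfolding gram_def using dG by (intro differentiable_sum) auto
      have "((\<lambda>y. (z' (y - x) \<bullet> b) *\<^sub>R gram (G y) b) has_derivative
             (\<lambda>h. (z' h \<bullet> b) *\<^sub>R gram (G x) b)) (at x)" for b
      proof -
        have "((\<lambda>y. z' (y - x)) has_derivative z') (at x)"
          by (rule has_derivative_eq_rhs[OF bounded_linear.has_derivative[OF \<open>bounded_linear z'\<close>]])
             (auto intro!: derivative_eq_intros)
        then have "((\<lambda>y. z' (y - x) \<bullet> b) has_derivative (\<lambda>h. z' h \<bullet> b)) (at x)"
          by (rule has_derivative_inner_left)
        from has_derivative_scaleR[OF this d[of b, unfolded frechet_derivative_works]]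
        show ?thesis
          by (rule has_derivative_eq_rhs) (simp add: linear_0[OF z'])
      qed
      then have "((\<lambda>y. \<Sum>b\<in>Basis. (z' (y - x) \<bullet> b) *\<^sub>R gram (G y) b) has_derivative
             (\<lambda>h. \<Sum>b\<in>Basis. (z' h \<bullet> b) *\<^sub>R gram (G x) b)) (at x)"
        by (rule has_derivative_sum)
      then have "((\<lambda>y. \<Sum>b\<in>Basis. (z' (y - x) \<bullet> b) *\<^sub>R gram (G y) b) has_derivative
             (\<lambda>h. gram (G x) (z' h))) (at x)"
        by (rule has_derivative_eq_rhs)
           (rule ext, rule linear_sum_Basis[OF linear_gram[OF G[OF assms(2)]], symmetric])
      then show ?thesis
        by (rule has_derivative_transform_within_open[OF _ assms(1,2)]) (simp add: expand)
    qed
    show ?thesis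
      unfolding r_def
      by (rule has_derivative_eq_rhs[OF has_derivative_diff[OF has_derivative_diff[OF a' A'] gr]])
         (simp add: z'_def L(2))
  qed
  moreover have "r x = 0"
    using eq[OF assms(2)] linear_0[OF z'] linear_0[OF linear_gram[OF G[OF assms(2)]]]
    by (simp add: r_def)
  moreover define e where "e y = z y - z x - z' (y - x)" for y
  have "e x = 0"
    by (simp add: e_def linear_0[OF z'])
  moreover obtain B where B: "B > 0" "\<forall>\<^sub>F y in at x. \<forall>z. B * norm z \<le> norm (gram (G y) z)"
  proof (rule gram_bounded_below)
    show "\<forall>\<^sub>F y in at x. inner_form (G y)"
      using inS by eventually_elim (rule G)
    show "isCont (\<lambda>y. G y u v) x" for u v
      using dG differentiable_imp_continuous_within by blast
  qed (use G assms(2) in auto)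
  have "\<forall>\<^sub>F y in at x. norm (e y) \<le> 1 / B * norm (r y)"
    using B(2) inS
  proof eventually_elim
    case (elim y)
    have "gram (G y) (e y) = r y"
      using eq[OF elim(2)] linear_diff[OF linear_gram[OF G[OF elim(2)]]]
      by (simp add: e_def r_def)
    with elim(1) have "B * norm (e y) \<le> norm (r y)"
      by metis
    then show ?case
      using B(1) by (simp add: field_simps)
  qed
  ultimately have "(e has_derivative (\<lambda>h. 0)) (at x)"
    by (intro has_derivative_zero_bound[of r x e "1 / B"]) auto
  moreover have "((\<lambda>y. z x + z' (y - x)) has_derivative z') (at x)"
    by (rule has_derivative_eq_rhs[OF has_derivative_add[OF has_derivative_const
          bounded_linear.has_derivative[OF \<open>bounded_linear z'\<close>]]])
       (auto intro!: derivative_eq_intros)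
  ultimately have "((\<lambda>y. e y + (z x + z' (y - x))) has_derivative (\<lambda>h. 0 + z' h)) (at x)"
    by (rule has_derivative_add)
  then have "z differentiable (at x)"
    by (auto simp: e_def differentiable_def)
  then show ?thesis
    by (simp add: z_def[abs_def])
qed

section \<open>Differentiation in a chart\<close>

text \<open>
  The derivative at the image of \<open>p\<close> of the local representative of \<open>f\<close>, which makes
  differentiability explicit where \<open>chart_deriv\<close> returns an arbitrary value for functions without
  derivative.
\<close>

definition has_chart_derivative ::
    "('a, 'e::euclidean_space, 'i) atlas \<Rightarrow> 'i \<Rightarrow> ('a \<Rightarrow> 'v::real_normed_vector) \<Rightarrow> 'a \<Rightarrow> ('e \<Rightarrow> 'v) \<Rightarrow> bool"
where
  "has_chart_derivative M i f p f' \<longleftrightarrow>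
     ((\<lambda>x. f (chart_inv M i x)) has_derivative f') (at (chart_map M i p))"

definition chart_differentiable ::
    "('a, 'e::euclidean_space, 'i) atlas \<Rightarrow> 'i \<Rightarrow> ('a \<Rightarrow> 'v::real_normed_vector) \<Rightarrow> 'a \<Rightarrow> bool"
where
  "chart_differentiable M i f p \<longleftrightarrow>
     (\<lambda>x. f (chart_inv M i x)) differentiable (at (chart_map M i p))"

lemma chart_deriv_eqI:
  assumes "has_chart_derivative M i f p f'"
  shows "chart_deriv M i f p = f'"
  using frechet_derivative_at[OF assms[unfolded has_chart_derivative_def]]
  by (auto simp: chart_deriv_def)

lemma has_chart_derivative_iff:
  "has_chart_derivative M i f p f' \<longleftrightarrow> chart_differentiable M i f p \<and> chart_deriv M i f p = f'"
  unfolding has_chart_derivative_def chart_differentiable_def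
  by (metis chart_deriv_eqI differentiableI frechet_derivative_works has_chart_derivative_def)

lemma chart_differentiableD:
  "chart_differentiable M i f p \<Longrightarrow> has_chart_derivative M i f p (chart_deriv M i f p)"
  by (simp add: has_chart_derivative_iff)

lemma linear_chart_deriv:
  assumes "chart_differentiable M i f p"
  shows "linear (chart_deriv M i f p)"
  using chart_differentiableD[OF assms]
  by (auto simp: has_chart_derivative_def dest: has_derivative_linear)

lemma chart_deriv_const: "chart_deriv M i (\<lambda>q. c) p u = 0"
  by (simp add: chart_deriv_def)

lemma has_chart_derivative_add:
  "has_chart_derivative M i f p f' \<Longrightarrow> has_chart_derivative M i h p h' \<Longrightarrow>
   has_chart_derivative M i (\<lambda>q. f q + h q) p (\<lambda>u. f' u + h' u)"
  unfolding has_chart_derivative_def by (rule has_derivative_add)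

lemma has_chart_derivative_linear:
  "bounded_linear L \<Longrightarrow> has_chart_derivative M i f p f' \<Longrightarrow>
   has_chart_derivative M i (\<lambda>q. L (f q)) p (\<lambda>u. L (f' u))"
  unfolding has_chart_derivative_def by (rule bounded_linear.has_derivative)

lemma chart_deriv_add:
  assumes "chart_differentiable M i f p" "chart_differentiable M i h p"
  shows "chart_deriv M i (\<lambda>q. f q + h q) p u = chart_deriv M i f p u + chart_deriv M i h p u"
  using chart_deriv_eqI[OF has_chart_derivative_add] assms[THEN chart_differentiableD] by fastforce

lemma chart_deriv_linear:
  assumes "bounded_linear L" "chart_differentiable M i f p"
  shows "chart_deriv M i (\<lambda>q. L (f q)) p u = L (chart_deriv M i f p u)"
  using chart_deriv_eqI[OF has_chart_derivative_linear[OF assms(1)]]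
    assms(2)[THEN chart_differentiableD] by fastforce

text \<open>
  The openness of the image makes differentiation local: functions that agree on the chart
  domain have representatives that agree near every point of the image.
\<close>

locale coordinate_chart =
  fixes M :: "('a, 'e::euclidean_space, 'i) atlas" and i :: 'i
  assumes open_img: "open (chart_img M i)"
    and inj_chart: "inj_on (chart_map M i) (chart_dom M i)"
begin

lemma chart_inv_map: "p \<in> chart_dom M i \<Longrightarrow> chart_inv M i (chart_map M i p) = p"
  by (simp add: chart_inv_def inj_chart)

lemma map_chart_inv: "x \<in> chart_img M i \<Longrightarrow> chart_map M i (chart_inv M i x) = x"
  by (simp add: chart_inv_def chart_img_def f_inv_into_f)

lemma chart_map_in: "p \<in> chart_dom M i \<Longrightarrow> chart_map M i p \<in> chart_img M i"
  by (simp add: chart_img_def)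

lemma chart_inv_in: "x \<in> chart_img M i \<Longrightarrow> chart_inv M i x \<in> chart_dom M i"
  by (simp add: chart_inv_def chart_img_def inv_into_into)

lemma has_chart_derivative_cong:
  assumes "p \<in> chart_dom M i" "has_chart_derivative M i f p f'"
    and "\<And>q. q \<in> chart_dom M i \<Longrightarrow> f q = h q"
  shows "has_chart_derivative M i h p f'"
  using assms(2) unfolding has_chart_derivative_def
  by (rule has_derivative_transform_within_open[OF _ open_img chart_map_in[OF assms(1)]])
     (simp add: assms(3) chart_inv_in)

lemma chart_deriv_cong:
  assumes "p \<in> chart_dom M i" "chart_differentiable M i f p"
    and "\<And>q. q \<in> chart_dom M i \<Longrightarrow> f q = h q"
  shows "chart_deriv M i f p = chart_deriv M i h p"
  using has_chart_derivative_cong[OF assms(1) chart_differentiableD[OF assms(2)] assms(3)]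
  by (simp add: chart_deriv_eqI)

lemma smooth_chart_differentiable:
  assumes "smooth_in_chart M i f" "p \<in> chart_dom M i"
  shows "chart_differentiable M i f p"
  using assms chart_map_in smooth_on_differentiable
  unfolding smooth_in_chart_def chart_differentiable_def by blast

lemma smooth_in_chart_linear_image:
  assumes "bounded_linear L" "smooth_in_chart M i f"
  shows "smooth_in_chart M i (\<lambda>p. L (f p))"
  using assms C_on_bounded_linear_image[OF open_img assms(1)]
  by (simp add: smooth_in_chart_def smooth_on_def)

lemma chart_deriv_inv:
  assumes "x \<in> chart_img M i"
  shows "chart_deriv M i f (chart_inv M i x) u = frechet_derivative (\<lambda>x. f (chart_inv M i x)) (at x) u"
  by (simp add: chart_deriv_def map_chart_inv assms)

lemma smooth_chart_deriv:
  assumes "smooth_in_chart M i f"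
  shows "smooth_in_chart M i (\<lambda>p. chart_deriv M i f p u)"
  unfolding smooth_in_chart_def smooth_on_def
proof
  fix k
  have "C_on k (chart_img M i) (\<lambda>x. frechet_derivative (\<lambda>x. f (chart_inv M i x)) (at x) u)"
    using smooth_on_frechet_derivative assms unfolding smooth_in_chart_def smooth_on_def by metis
  then show "C_on k (chart_img M i) (\<lambda>x. chart_deriv M i f (chart_inv M i x) u)"
    by (rule C_on_cong[OF open_img]) (simp add: chart_deriv_inv)
qed

lemma chart_deriv_commute:
  fixes f :: "'a \<Rightarrow> real"
  assumes "smooth_in_chart M i f" "p \<in> chart_dom M i"
  shows "chart_deriv M i (\<lambda>q. chart_deriv M i f q u) p v =
         chart_deriv M i (\<lambda>q. chart_deriv M i f q v) p u"
proof -
  let ?F = "\<lambda>x. f (chart_inv M i x)"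
  let ?x = "chart_map M i p"
  have F: "smooth_on (chart_img M i) ?F"
    using assms(1) by (simp add: smooth_in_chart_def)
  have "chart_deriv M i (\<lambda>q. chart_deriv M i f q a) p b =
      frechet_derivative (\<lambda>x. frechet_derivative ?F (at x) a) (at ?x) b" for a b
    unfolding chart_deriv_def[of M i "\<lambda>q. chart_deriv M i f q a"]
    by (subst frechet_derivative_transform_within_open[OF _ open_img chart_map_in[OF assms(2)]])
       (use smooth_chart_differentiable[OF smooth_chart_deriv[OF assms(1)] assms(2)]
         in \<open>auto simp: chart_differentiable_def chart_deriv_inv\<close>)
  then show ?thesis
    using frechet_derivative_commute[OF open_img chart_map_in[OF assms(2)] F] by simp
qed

end


section \<open>The Levi-Civita connection and its curvature\<close>

locale riemannian_chart = coordinate_chart M i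
  for M :: "('a, 'e::euclidean_space, 'i) atlas" and i :: 'i +
  fixes g :: "('a, 'e, 'i) metric"
  assumes smooth_g: "smooth_in_chart M i (\<lambda>p. g i p u v)"
    and inner_form_g: "p \<in> chart_dom M i \<Longrightarrow> inner_form (g i p)"
begin

abbreviation dg :: "'a \<Rightarrow> 'e \<Rightarrow> 'e \<Rightarrow> 'e \<Rightarrow> real" where
  "dg p x u v \<equiv> chart_deriv M i (\<lambda>q. g i q u v) p x"

definition koszul :: "'a \<Rightarrow> 'e \<Rightarrow> 'e \<Rightarrow> 'e \<Rightarrow> real" where
  "koszul p u v w = (dg p u v w + dg p v u w - dg p w u v) / 2"

lemma g_linear:
  assumes "p \<in> chart_dom M i"
  shows "linear (g i p u)" "linear (\<lambda>u. g i p u v)"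
  using inner_form_linear[OF inner_form_g[OF assms]] .

lemma g_sym: "p \<in> chart_dom M i \<Longrightarrow> g i p u v = g i p v u"
  using inner_form_g by (simp add: inner_form_def)

lemma g_differentiable:
  "p \<in> chart_dom M i \<Longrightarrow> chart_differentiable M i (\<lambda>q. g i q u v) p"
  by (rule smooth_chart_differentiable[OF smooth_g])

lemma dg_sym: "p \<in> chart_dom M i \<Longrightarrow> dg p x u v = dg p x v u"
  by (rule fun_cong[OF chart_deriv_cong[OF _ g_differentiable]]) (simp_all add: g_sym)

lemma dg_linear:
  assumes "p \<in> chart_dom M i"
  shows "linear (\<lambda>x. dg p x u v)" "linear (\<lambda>u. dg p x u v)" "linear (\<lambda>v. dg p x u v)"
proof -
  show "linear (\<lambda>x. dg p x u v)"
    by (rule linear_chart_deriv[OF g_differentiable[OF assms]])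
  show *: "linear (\<lambda>u. dg p x u v)" for v
  proof (rule linearI)
    fix a b c
    have "dg p x (a + b) v = chart_deriv M i (\<lambda>q. g i q a v + g i q b v) p x"
      by (subst chart_deriv_cong[OF assms g_differentiable[OF assms]])
         (auto simp: linear_add[OF g_linear(2)])
    also have "\<dots> = dg p x a v + dg p x b v"
      by (rule chart_deriv_add[OF g_differentiable[OF assms] g_differentiable[OF assms]])
    finally show "dg p x (a + b) v = dg p x a v + dg p x b v" .
    have "dg p x (c *\<^sub>R a) v = chart_deriv M i (\<lambda>q. c *\<^sub>R g i q a v) p x"
      by (subst chart_deriv_cong[OF assms g_differentiable[OF assms]])
         (auto simp: linear_cmul[OF g_linear(2)])
    also have "\<dots> = c *\<^sub>R dg p x a v"
      by (rule chart_deriv_linear[OF bounded_linear_scaleR_right g_differentiable[OF assms]])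
    finally show "dg p x (c *\<^sub>R a) v = c *\<^sub>R dg p x a v" .
  qed
  show "linear (\<lambda>v. dg p x u v)"
    by (subst dg_sym[OF assms]) (rule *)
qed

lemma koszul_linear:
  assumes "p \<in> chart_dom M i"
  shows "linear (koszul p u v)"
  by (rule linearI)
     (simp_all add: koszul_def field_simps linear_add[OF dg_linear(1)[OF assms]]
        linear_add[OF dg_linear(3)[OF assms]] linear_cmul[OF dg_linear(1)[OF assms]]
        linear_cmul[OF dg_linear(3)[OF assms]])

lemma christoffel_eq_sharp: "christoffel M g i p u v = sharp (g i p) (koszul p u v)"
  by (simp add: christoffel_def koszul_def[abs_def])

lemma g_christoffel:
  assumes "p \<in> chart_dom M i"
  shows "g i p (christoffel M g i p u v) w = koszul p u v w"
  unfolding christoffel_eq_sharp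
  by (rule sharp_works[OF inner_form_g[OF assms] koszul_linear[OF assms]])

lemma christoffel_eqI:
  assumes "p \<in> chart_dom M i" "\<And>w. g i p z w = koszul p u v w"
  shows "christoffel M g i p u v = z"
  unfolding christoffel_eq_sharp by (rule sharp_eqI[OF inner_form_g[OF assms(1)] assms(2)])

lemma christoffel_sym:
  assumes "p \<in> chart_dom M i"
  shows "christoffel M g i p u v = christoffel M g i p v u"
  using assms dg_sym[OF assms, of u v]
  by (intro christoffel_eqI) (simp_all add: g_christoffel koszul_def)

lemma christoffel_linear:
  assumes "p \<in> chart_dom M i"
  shows "linear (christoffel M g i p u)" "linear (\<lambda>u. christoffel M g i p u v)"
proof -
  show *: "linear (christoffel M g i p u)" for u
  proof (rule linearI)
    fix a b c
    show "christoffel M g i p u (a + b) = christoffel M g i p u a + christoffel M g i p u b"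
      using assms
      by (intro christoffel_eqI)
         (simp_all add: linear_add[OF g_linear(2)] g_christoffel koszul_def field_simps
            linear_add[OF dg_linear(1)] linear_add[OF dg_linear(2)] linear_add[OF dg_linear(3)])
    show "christoffel M g i p u (c *\<^sub>R a) = c *\<^sub>R christoffel M g i p u a"
      using assms
      by (intro christoffel_eqI)
         (simp_all add: linear_cmul[OF g_linear(2)] g_christoffel koszul_def field_simps
            linear_cmul[OF dg_linear(1)] linear_cmul[OF dg_linear(2)] linear_cmul[OF dg_linear(3)])
  qed
  show "linear (\<lambda>u. christoffel M g i p u v)"
    by (subst christoffel_sym[OF assms]) (rule *)
qed

lemma koszul_differentiable:
  assumes "p \<in> chart_dom M i"
  shows "chart_differentiable M i (\<lambda>q. koszul q u v w) p"
  unfolding koszul_def chart_differentiable_def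
  using smooth_chart_differentiable[OF smooth_chart_deriv[OF smooth_g] assms]
  by (intro differentiable_divide differentiable_diff differentiable_add)
     (auto simp: chart_differentiable_def)

text \<open>
  Without this the derivatives of Christoffel symbols in the curvature would not be additive,
  and the curvature of a product could not be computed.
\<close>

lemma christoffel_differentiable:
  assumes "p \<in> chart_dom M i"
  shows "chart_differentiable M i (\<lambda>q. christoffel M g i q u v) p"
  unfolding christoffel_eq_sharp chart_differentiable_def
proof (rule sharp_differentiable[OF open_img chart_map_in[OF assms]])
  show "(\<lambda>y. g i (chart_inv M i y) a b) differentiable (at (chart_map M i p))" for a b
    using g_differentiable[OF assms] by (simp add: chart_differentiable_def)
  show "(\<lambda>y. koszul (chart_inv M i y) u v w) differentiable (at (chart_map M i p))" for w
    using koszul_differentiable[OF assms] by (simp add: chart_differentiable_def)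
qed (simp_all add: inner_form_g koszul_linear chart_inv_in)

text \<open>
  Adding the two Koszul expressions that differ by an interchange of the last two arguments
  leaves the derivative of the metric; the other terms cancel in pairs.
\<close>

lemma metric_compatible:
  assumes "p \<in> chart_dom M i"
  shows "dg p x u v = g i p (christoffel M g i p x u) v + g i p u (christoffel M g i p x v)"
proof -
  have "g i p u (christoffel M g i p x v) = koszul p x v u"
    by (rule trans[OF g_sym[OF assms] g_christoffel[OF assms]])
  moreover have "g i p (christoffel M g i p x u) v = koszul p x u v"
    by (rule g_christoffel[OF assms])
  moreover have "koszul p x u v + koszul p x v u = dg p x u v"
    by (simp add: koszul_def dg_sym[OF assms, of v u] add_divide_distrib[symmetric])
  ultimately show ?thesis
    by simp
qed

text \<open>
  The product rule for the contraction of the metric with a vector field \<open>a\<close> is reduced to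
  products of functions by expanding \<open>a\<close> in the basis.
\<close>

lemma has_chart_derivative_g:
  assumes p: "p \<in> chart_dom M i" and a: "has_chart_derivative M i a p a'"
  shows "has_chart_derivative M i (\<lambda>q. g i q (a q) v) p (\<lambda>x. dg p x (a p) v + g i p (a' x) v)"
proof -
  have "has_chart_derivative M i (\<lambda>q. \<Sum>b\<in>Basis. (a q \<bullet> b) * g i q b v) p
      (\<lambda>x. \<Sum>b\<in>Basis. (a p \<bullet> b) * dg p x b v + (a' x \<bullet> b) * g i p b v)"
    unfolding has_chart_derivative_def
  proof (rule has_derivative_sum)
    fix b :: 'e
    have "((\<lambda>x. a (chart_inv M i x) \<bullet> b) has_derivative (\<lambda>x. a' x \<bullet> b)) (at (chart_map M i p))"
      using a by (intro has_derivative_inner_left) (simp add: has_chart_derivative_def)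
    from has_derivative_mult[OF this
        chart_differentiableD[OF g_differentiable[OF p], unfolded has_chart_derivative_def]]
    show "((\<lambda>x. (a (chart_inv M i x) \<bullet> b) * g i (chart_inv M i x) b v) has_derivative
       (\<lambda>x. (a p \<bullet> b) * dg p x b v + (a' x \<bullet> b) * g i p b v)) (at (chart_map M i p))"
      by (simp add: chart_inv_map[OF p])
  qed
  moreover have "(\<lambda>x. \<Sum>b\<in>Basis. (a p \<bullet> b) * dg p x b v + (a' x \<bullet> b) * g i p b v) =
      (\<lambda>x. dg p x (a p) v + g i p (a' x) v)"
  proof
    fix x
    from linear_sum_Basis[OF dg_linear(2)[OF p, where x = x and v = v], of "a p"]
      linear_sum_Basis[OF g_linear(2)[OF p, where v = v], of "a' x"]
    show "(\<Sum>b\<in>Basis. (a p \<bullet> b) * dg p x b v + (a' x \<bullet> b) * g i p b v) =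
        dg p x (a p) v + g i p (a' x) v"
      by (simp add: sum.distrib)
  qed
  ultimately have "has_chart_derivative M i (\<lambda>q. \<Sum>b\<in>Basis. (a q \<bullet> b) * g i q b v) p
      (\<lambda>x. dg p x (a p) v + g i p (a' x) v)"
    by (simp only:)
  then show ?thesis
  proof (rule has_chart_derivative_cong[OF p])
    fix q assume "q \<in> chart_dom M i"
    from linear_sum_Basis[OF g_linear(2)[OF this, where v = v], of "a q"]
    show "(\<Sum>b\<in>Basis. (a q \<bullet> b) * g i q b v) = g i q (a q) v"
      by simp
  qed
qed

abbreviation D_christoffel :: "'a \<Rightarrow> 'e \<Rightarrow> 'e \<Rightarrow> 'e \<Rightarrow> 'e" where
  "D_christoffel p x u v \<equiv> chart_deriv M i (\<lambda>q. christoffel M g i q u v) p x"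

lemma D_christoffel_linear:
  assumes "p \<in> chart_dom M i"
  shows "linear (\<lambda>x. D_christoffel p x u v)"
    and "linear (\<lambda>u. D_christoffel p x u v)" and "linear (\<lambda>v. D_christoffel p x u v)"
proof -
  note d = christoffel_differentiable[OF assms]
  show "linear (\<lambda>x. D_christoffel p x u v)"
    by (rule linear_chart_deriv[OF d])
  show *: "linear (\<lambda>v. D_christoffel p x u v)" for u
  proof (rule linearI)
    fix a b c
    have "D_christoffel p x u (a + b) =
        chart_deriv M i (\<lambda>q. christoffel M g i q u a + christoffel M g i q u b) p x"
      by (subst chart_deriv_cong[OF assms d]) (auto simp: linear_add[OF christoffel_linear(1)])
    also have "\<dots> = D_christoffel p x u a + D_christoffel p x u b"
      by (rule chart_deriv_add[OF d d])
    finally show "D_christoffel p x u (a + b) = D_christoffel p x u a + D_christoffel p x u b" .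
    have "D_christoffel p x u (c *\<^sub>R a) = chart_deriv M i (\<lambda>q. c *\<^sub>R christoffel M g i q u a) p x"
      by (subst chart_deriv_cong[OF assms d]) (auto simp: linear_cmul[OF christoffel_linear(1)])
    also have "\<dots> = c *\<^sub>R D_christoffel p x u a"
      by (rule chart_deriv_linear[OF bounded_linear_scaleR_right d])
    finally show "D_christoffel p x u (c *\<^sub>R a) = c *\<^sub>R D_christoffel p x u a" .
  qed
  have "D_christoffel p x u v = D_christoffel p x v u" for u v
    by (rule fun_cong[OF chart_deriv_cong[OF assms d]]) (rule christoffel_sym)
  from this[of _ v] show "linear (\<lambda>u. D_christoffel p x u v)"
    by (simp only: *)
qed

lemma curvature_skew: "curvature M g i p x y v = - curvature M g i p y x v"
  by (simp add: curvature_def)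

lemma curvature_linear:
  assumes "p \<in> chart_dom M i"
  shows "linear (\<lambda>x. curvature M g i p x y v)" "linear (curvature M g i p x y)"
proof -
  note rules = linear_add[OF D_christoffel_linear(1)[OF assms]]
    linear_add[OF D_christoffel_linear(2)[OF assms]] linear_add[OF D_christoffel_linear(3)[OF assms]]
    linear_add[OF christoffel_linear(1)[OF assms]] linear_add[OF christoffel_linear(2)[OF assms]]
    linear_cmul[OF D_christoffel_linear(1)[OF assms]]
    linear_cmul[OF D_christoffel_linear(2)[OF assms]]
    linear_cmul[OF D_christoffel_linear(3)[OF assms]]
    linear_cmul[OF christoffel_linear(1)[OF assms]] linear_cmul[OF christoffel_linear(2)[OF assms]]
  show "linear (\<lambda>x. curvature M g i p x y v)"
    by (rule linearI) (simp_all add: curvature_def rules algebra_simps)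
  show "linear (curvature M g i p x y)"
    by (rule linearI) (simp_all add: curvature_def rules algebra_simps)
qed

text \<open>
  By metric compatibility the second derivative of \<open>g v v\<close> along \<open>y\<close> and then \<open>x\<close>, for constant
  \<open>v\<close>, is twice \<open>g (\<Gamma>\<^sub>x \<Gamma>\<^sub>y v) v + g (\<Gamma>\<^sub>y v) (\<Gamma>\<^sub>x v) + g ((D\<^sub>x \<Gamma>\<^sub>y) v) v\<close>. Antisymmetrising in \<open>x\<close> and \<open>y\<close> kills
  the left-hand side and leaves the curvature on the right.
\<close>

lemma curvature_metric_skew:
  assumes p: "p \<in> chart_dom M i"
  shows "g i p (curvature M g i p x y v) v = 0"
proof -
  let ?\<Gamma> = "christoffel M g i"
  have second: "chart_deriv M i (\<lambda>q. dg q y v v) p x =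
      2 * (g i p (?\<Gamma> p x (?\<Gamma> p y v)) v + g i p (?\<Gamma> p y v) (?\<Gamma> p x v) + g i p (D_christoffel p x y v) v)"
    for x y
  proof -
    have "has_chart_derivative M i (\<lambda>q. 2 * g i q (?\<Gamma> q y v) v) p
        (\<lambda>x. 2 * (dg p x (?\<Gamma> p y v) v + g i p (D_christoffel p x y v) v))"
      by (rule has_chart_derivative_linear[OF bounded_linear_mult_right has_chart_derivative_g[OF p
            chart_differentiableD[OF christoffel_differentiable[OF p]]]])
    then have "has_chart_derivative M i (\<lambda>q. dg q y v v) p
        (\<lambda>x. 2 * (dg p x (?\<Gamma> p y v) v + g i p (D_christoffel p x y v) v))"
      by (rule has_chart_derivative_cong[OF p]) (simp add: metric_compatible g_sym)
    from chart_deriv_eqI[OF this] show ?thesis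
      by (simp add: metric_compatible[OF p])
  qed
  have "chart_deriv M i (\<lambda>q. dg q y v v) p x = chart_deriv M i (\<lambda>q. dg q x v v) p y"
    by (rule chart_deriv_commute[OF smooth_g p])
  then show ?thesis
    unfolding second curvature_def
    by (simp add: linear_add[OF g_linear(2)[OF p]] linear_diff[OF g_linear(2)[OF p]]
        g_sym[OF p, of "?\<Gamma> p y v" "?\<Gamma> p x v"])
qed

end

section \<open>Ricci curvature of Einstein manifolds\<close>

text \<open>
  In a plane, a skew endomorphism \<open>S\<close> is a multiple of the rotation by a right angle, and
  pairing it with the area form of the coordinates gives a multiple of the inner product. The
  left-hand side is the Ricci tensor of a curvature \<open>R(u, v) = \<omega>(u, v) S\<close>. Skewness on \<open>b\<close>, on \<open>c\<close> and on
  \<open>b + c\<close> gives three linear equations for the four entries of \<open>S\<close>, which leave one free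
  parameter \<open>\<kappa>\<close>.
\<close>

lemma skew_endomorphism_plane:
  fixes G :: "'e::euclidean_space \<Rightarrow> 'e \<Rightarrow> real"
  assumes basis: "(Basis :: 'e set) = {b, c}" "b \<noteq> c"
    and G: "inner_form G" and S: "linear S" and skew: "\<And>w. G (S w) w = 0"
  obtains \<kappa> where "\<And>v w. (v \<bullet> c) * (S w \<bullet> b) - (v \<bullet> b) * (S w \<bullet> c) = \<kappa> * G v w"
proof -
  have expand: "f w = (w \<bullet> b) *\<^sub>R f b + (w \<bullet> c) *\<^sub>R f c" if "linear f"
    for f :: "'e \<Rightarrow> 'v::real_vector" and w
    using linear_sum_Basis[OF that, of w] basis(2) unfolding basis(1) by simp
  have Gl: "G u w = (u \<bullet> b) * G b w + (u \<bullet> c) * G c w" for u w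
    using expand[OF inner_form_linear(2)[OF G, where v = w], of u] by simp
  have Gr: "G u w = (w \<bullet> b) * G u b + (w \<bullet> c) * G u c" for u w
    using expand[OF inner_form_linear(1)[OF G, where u = u], of w] by simp
  have sym: "G c b = G b c"
    using G by (simp add: inner_form_def)
  have "b \<in> Basis" "c \<in> Basis"
    using basis by auto
  then have pos: "G b b > 0" "G c c > 0"
    using G nonzero_Basis by (auto simp: inner_form_def)
  have sb: "(S b \<bullet> b) * G b b + (S b \<bullet> c) * G b c = 0"
    using skew[of b] Gl[of "S b" b] sym by simp
  have sc: "(S c \<bullet> b) * G b c + (S c \<bullet> c) * G c c = 0"
    using skew[of c] Gl[of "S c" c] by simp
  have "G (S (b + c)) (b + c) = G (S b) b + G (S b) c + G (S c) b + G (S c) c"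
    by (simp add: linear_add[OF S] linear_add[OF inner_form_linear(1)[OF G]]
        linear_add[OF inner_form_linear(2)[OF G]])
  then have "G (S b) c + G (S c) b = 0"
    using skew by simp
  then have sbc: "(S b \<bullet> b) * G b c + (S b \<bullet> c) * G c c + (S c \<bullet> b) * G b b + (S c \<bullet> c) * G b c = 0"
    using Gl[of "S b" c] Gl[of "S c" b] sym by simp
  \<comment> \<open>The entry \<open>(b, b)\<close> of the claim forces this value.\<close>
  define \<kappa> where "\<kappa> = - (S b \<bullet> c) / G b b"
  have k1: "S b \<bullet> c = - \<kappa> * G b b"
    using pos by (simp add: \<kappa>_def)
  have k2: "S b \<bullet> b = \<kappa> * G b c"
  proof -
    have "(S b \<bullet> b - \<kappa> * G b c) * G b b = 0"
      using sb unfolding k1 by (simp add: algebra_simps)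
    with pos show ?thesis by simp
  qed
  \<comment> \<open>The Gram determinant is positive: project \<open>b\<close> orthogonally off \<open>c\<close>.\<close>
  have D: "G b b * G c c - G b c * G b c > 0"
  proof -
    have "b - (G b c / G c c) *\<^sub>R c \<noteq> 0"
    proof
      assume "b - (G b c / G c c) *\<^sub>R c = 0"
      then have "(b - (G b c / G c c) *\<^sub>R c) \<bullet> b = 0" by simp
      moreover have "c \<bullet> b = 0" "b \<bullet> b = 1"
        using \<open>b \<in> Basis\<close> \<open>c \<in> Basis\<close> basis(2) by (auto simp: inner_Basis)
      ultimately show False by (simp add: inner_diff_left)
    qed
    then have "G (b - (G b c / G c c) *\<^sub>R c) (b - (G b c / G c c) *\<^sub>R c) > 0"
      using G by (simp add: inner_form_def)
    also have "G (b - (G b c / G c c) *\<^sub>R c) (b - (G b c / G c c) *\<^sub>R c) = G b b - G b c * G b c / G c c"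
      using pos
      by (simp add: linear_diff[OF inner_form_linear(1)[OF G]] linear_diff[OF inner_form_linear(2)[OF G]]
          linear_cmul[OF inner_form_linear(1)[OF G]] linear_cmul[OF inner_form_linear(2)[OF G]] sym
          field_simps)
    finally show ?thesis
      using pos by (simp add: field_simps)
  qed
  have k3: "S c \<bullet> b = \<kappa> * G c c" and k4: "S c \<bullet> c = - \<kappa> * G b c"
  proof -
    have "(S c \<bullet> b - \<kappa> * G c c) * (G b b * G c c - G b c * G b c) = 0"
      using sbc sc unfolding k1 k2 by algebra
    with D show 1: "S c \<bullet> b = \<kappa> * G c c" by simp
    have "(S c \<bullet> c + \<kappa> * G b c) * G c c = 0"
      using sc unfolding 1 by (simp add: algebra_simps)
    with pos show "S c \<bullet> c = - \<kappa> * G b c" by simp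
  qed
  have "(v \<bullet> c) * (S w \<bullet> b) - (v \<bullet> b) * (S w \<bullet> c) = \<kappa> * G v w" for v w
  proof -
    have "S w = (w \<bullet> b) *\<^sub>R S b + (w \<bullet> c) *\<^sub>R S c"
      by (rule expand[OF S])
    then have Sb: "S w \<bullet> b = (w \<bullet> b) * (\<kappa> * G b c) + (w \<bullet> c) * (\<kappa> * G c c)"
      and Sc: "S w \<bullet> c = (w \<bullet> b) * (- \<kappa> * G b b) + (w \<bullet> c) * (- \<kappa> * G b c)"
      using k1 k2 k3 k4 by (simp_all add: inner_add_left)
    show ?thesis
      unfolding Sb Sc Gl[of v w] Gr[of b w] Gr[of c w] sym by (simp add: algebra_simps)
  qed
  then show thesis by (rule that)
qed

context riemannian_chart
begin

lemma ricci_dim_1: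
  assumes "DIM('e) = 1" "p \<in> chart_dom M i"
  shows "ricci M g i p v w = 0"
proof -
  obtain b where b: "(Basis :: 'e set) = {b}"
    using assms(1) by (auto simp: card_1_singleton_iff)
  have "curvature M g i p b v w = - curvature M g i p v b w"
    by (rule curvature_skew)
  also have "curvature M g i p v b w = (v \<bullet> b) *\<^sub>R curvature M g i p b b w"
    using linear_sum_Basis[OF curvature_linear(1)[OF assms(2), where y = b and v = w], of v]
    unfolding b by simp
  also have "curvature M g i p b b w = 0"
    using curvature_skew[of p b b w] by (simp add: eq_neg_iff_add_eq_0 flip: scaleR_2)
  finally show ?thesis
    by (simp add: ricci_def endo_trace_def b)
qed

lemma ricci_dim_2:
  assumes "DIM('e) = 2" "p \<in> chart_dom M i"
  obtains \<kappa> where "\<And>v w. ricci M g i p v w = \<kappa> * g i p v w"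
proof -
  obtain b c where bc: "(Basis :: 'e set) = {b, c}" "b \<noteq> c"
    using assms(1) by (meson card_2_iff)
  define S where "S w = curvature M g i p b c w" for w
  have zero: "curvature M g i p a a w = 0" for a w
    using curvature_skew[of p a a w] by (simp add: eq_neg_iff_add_eq_0 flip: scaleR_2)
  have expand: "curvature M g i p v a w = (v \<bullet> b) *\<^sub>R curvature M g i p b a w + (v \<bullet> c) *\<^sub>R curvature M g i p c a w"
    for v a w
    using linear_sum_Basis[OF curvature_linear(1)[OF assms(2), where y = a and v = w], of v] bc(2)
    unfolding bc(1) by simp
  have "curvature M g i p c b w = - S w" for w
    unfolding S_def by (rule curvature_skew)
  then have Rb: "curvature M g i p b v w = (v \<bullet> c) *\<^sub>R S w"
    and Rc: "curvature M g i p c v w = - (v \<bullet> b) *\<^sub>R S w" for v w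
    using curvature_skew[of p b v w] curvature_skew[of p c v w] expand[of v b w] expand[of v c w] zero
    by (simp_all add: S_def)
  have "ricci M g i p v w = (v \<bullet> c) * (S w \<bullet> b) - (v \<bullet> b) * (S w \<bullet> c)" for v w
    using bc(2) by (simp add: ricci_def endo_trace_def bc(1) Rb Rc)
  moreover obtain \<kappa> where "\<And>v w. (v \<bullet> c) * (S w \<bullet> b) - (v \<bullet> b) * (S w \<bullet> c) = \<kappa> * g i p v w"
  proof (rule skew_endomorphism_plane[OF bc inner_form_g[OF assms(2)]])
    show "linear S"
      unfolding S_def by (rule curvature_linear(2)[OF assms(2)])
    show "g i p (S w) w = 0" for w
      unfolding S_def by (rule curvature_metric_skew[OF assms(2)])
  qed blast
  ultimately show thesis
    by (intro that[of \<kappa>]) simp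
qed

lemma scalar_curvature_of_ricci_multiple:
  assumes "p \<in> chart_dom M i" "\<And>v w. ricci M g i p v w = \<kappa> * g i p v w"
  shows "scalar_curvature M g i p = \<kappa> * real DIM('e)"
proof -
  have "sharp (g i p) (ricci M g i p u) = \<kappa> *\<^sub>R u" for u
    using assms by (intro sharp_eqI inner_form_g) (simp_all add: linear_cmul[OF g_linear(2)])
  then show ?thesis
    by (simp add: scalar_curvature_def endo_trace_def)
qed

end

lemma riemannian_chart_of_metric:
  assumes "smooth_manifold M" "riemannian_metric M g" "i \<in> charts M"
  shows "riemannian_chart M i g"
proof
  have "open (chart_img M i) \<and>
      homeomorphism (chart_dom M i) (chart_img M i) (chart_map M i) (chart_inv M i)"
    using assms(1,3) unfolding smooth_manifold_def by blast
  then show "open (chart_img M i)" "inj_on (chart_map M i) (chart_dom M i)"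
    by (auto simp: homeomorphism_def intro: inj_on_inverseI[of _ "chart_inv M i"])
  show "smooth_in_chart M i (\<lambda>p. g i p u v)" for u v
    using assms(2,3) by (simp add: riemannian_metric_def)
  show "inner_form (g i p)" if "p \<in> chart_dom M i" for p
    using assms(2,3) that by (auto simp: riemannian_metric_def inner_form_def)
qed

text \<open>
  The three meanings of Einstein lead to one formula. In dimension \<open>1\<close> both sides vanish; in
  higher dimensions the trace of \<open>Ric = \<kappa> g\<close> expresses \<open>\<kappa>\<close> through the scalar curvature, hence
  through \<open>\<mu>\<close>.
\<close>

lemma einstein_manifold_ricci:
  fixes M :: "('a::{second_countable_topology, t2_space}, 'e::euclidean_space, 'i) atlas"
  assumes E: "einstein_manifold M g \<mu>" and i: "i \<in> charts M" and p: "p \<in> chart_dom M i"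
  shows "ricci M g i p v w = 2 * (real DIM('e) - 1) * \<mu> * g i p v w"
proof -
  interpret riemannian_chart M i g
    using E i by (intro riemannian_chart_of_metric) (auto simp: einstein_manifold_def)
  consider "DIM('e) = 1" | "DIM('e) = 2" | "DIM('e) \<ge> 3"
    using DIM_positive[where 'a = 'e] by linarith
  then show ?thesis
  proof cases
    case 1
    then show ?thesis by (simp add: ricci_dim_1[OF _ p])
  next
    case 2
    obtain \<kappa> where \<kappa>: "\<And>v w. ricci M g i p v w = \<kappa> * g i p v w"
      using ricci_dim_2[OF 2 p] by blast
    have "\<mu> = scalar_curvature M g i p / (2 * real DIM('e) * (real DIM('e) - 1))"
      using E i p 2 by (simp add: einstein_manifold_def)
    then show ?thesis
      using scalar_curvature_of_ricci_multiple[OF p \<kappa>] 2 by (simp add: \<kappa>)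
  next
    case 3
    then obtain \<kappa> where "\<forall>i\<in>charts M. \<forall>p\<in>chart_dom M i. \<forall>u v. ricci M g i p u v = \<kappa> * g i p u v"
      using E unfolding einstein_manifold_def by blast
    then have \<kappa>: "ricci M g i p v w = \<kappa> * g i p v w" for v w
      using i p by blast
    have "\<mu> = scalar_curvature M g i p / (2 * real DIM('e) * (real DIM('e) - 1))"
      using E i p 3 by (simp add: einstein_manifold_def)
    then show ?thesis
      using scalar_curvature_of_ricci_multiple[OF p \<kappa>] 3 by (simp add: \<kappa>)
  qed
qed


section \<open>The geometry of a product\<close>

text \<open>
  Traces are sums of real values over the basis; \<open>sum_Basis_prod_eq\<close> covers values in the
  product space itself.
\<close>

lemma sum_Basis_prod:
  "(\<Sum>b\<in>(Basis :: ('e::euclidean_space \<times> 'f::euclidean_space) set). F b) =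
     (\<Sum>b\<in>Basis. F (b, 0)) + (\<Sum>b\<in>Basis. F (0, b))"
proof -
  have "inj_on (\<lambda>u. (u::'e, 0::'f)) Basis" "inj_on (\<lambda>u. (0::'e, u::'f)) Basis"
    by (auto intro!: inj_onI)
  then show ?thesis
    unfolding Basis_prod_def by (subst sum.union_disjoint) (auto simp: sum.reindex)
qed

lemma prod_atlas_simps [simp]:
  "charts (prod_atlas M N) = charts M \<times> charts N"
  "chart_dom (prod_atlas M N) (i, j) = chart_dom M i \<times> chart_dom N j"
  "chart_map (prod_atlas M N) (i, j) (p, q) = (chart_map M i p, chart_map N j q)"
  by (simp_all add: prod_atlas_def)

lemma chart_img_prod: "chart_img (prod_atlas M N) (i, j) = chart_img M i \<times> chart_img N j"
  by (force simp: chart_img_def)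

lemma metric_prod_apply:
  "metric_prod g h (i, j) z u v = g i (fst z) (fst u) (fst v) + h j (snd z) (snd u) (snd v)"
  by (simp add: metric_prod_def case_prod_unfold)

locale chart_product =
  A: coordinate_chart M i + B: coordinate_chart N j
  for M :: "('a, 'e::euclidean_space, 'i) atlas" and i
    and N :: "('b, 'f::euclidean_space, 'j) atlas" and j
begin

sublocale coordinate_chart "prod_atlas M N" "(i, j)"
proof
  show "open (chart_img (prod_atlas M N) (i, j))"
    by (simp add: chart_img_prod open_Times A.open_img B.open_img)
  show "inj_on (chart_map (prod_atlas M N) (i, j)) (chart_dom (prod_atlas M N) (i, j))"
    using A.inj_chart B.inj_chart by (auto simp: inj_on_def)
qed

lemma chart_inv_prod:
  assumes "x \<in> chart_img M i" "y \<in> chart_img N j"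
  shows "chart_inv (prod_atlas M N) (i, j) (x, y) = (chart_inv M i x, chart_inv N j y)"
proof -
  have "chart_inv (prod_atlas M N) (i, j)
      (chart_map (prod_atlas M N) (i, j) (chart_inv M i x, chart_inv N j y)) =
      (chart_inv M i x, chart_inv N j y)"
    by (rule chart_inv_map) (simp add: A.chart_inv_in B.chart_inv_in assms)
  then show ?thesis
    by (simp add: A.map_chart_inv B.map_chart_inv assms)
qed

lemma has_chart_derivative_fst:
  assumes "p \<in> chart_dom M i" "q \<in> chart_dom N j" "has_chart_derivative M i f p f'"
  shows "has_chart_derivative (prod_atlas M N) (i, j) (\<lambda>z. f (fst z)) (p, q) (\<lambda>u. f' (fst u))"
proof -
  have "((\<lambda>x. f (chart_inv M i (fst x))) has_derivative (\<lambda>u. f' (fst u)))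
      (at (chart_map (prod_atlas M N) (i, j) (p, q)))"
    using has_derivative_compose[OF has_derivative_fst[OF has_derivative_ident],
        of "\<lambda>x. f (chart_inv M i x)" f' "chart_map (prod_atlas M N) (i, j) (p, q)"] assms(3)
    by (simp add: has_chart_derivative_def)
  then show ?thesis
    unfolding has_chart_derivative_def
    by (rule has_derivative_transform_within_open[OF _ open_img chart_map_in])
       (auto simp: assms chart_img_prod chart_inv_prod)
qed

lemma has_chart_derivative_snd:
  assumes "p \<in> chart_dom M i" "q \<in> chart_dom N j" "has_chart_derivative N j f q f'"
  shows "has_chart_derivative (prod_atlas M N) (i, j) (\<lambda>z. f (snd z)) (p, q) (\<lambda>u. f' (snd u))"
proof -
  have "((\<lambda>x. f (chart_inv N j (snd x))) has_derivative (\<lambda>u. f' (snd u)))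
      (at (chart_map (prod_atlas M N) (i, j) (p, q)))"
    using has_derivative_compose[OF has_derivative_snd[OF has_derivative_ident],
        of "\<lambda>x. f (chart_inv N j x)" f' "chart_map (prod_atlas M N) (i, j) (p, q)"] assms(3)
    by (simp add: has_chart_derivative_def)
  then show ?thesis
    unfolding has_chart_derivative_def
    by (rule has_derivative_transform_within_open[OF _ open_img chart_map_in])
       (auto simp: assms chart_img_prod chart_inv_prod)
qed

lemma chart_deriv_Pair:
  assumes p: "p \<in> chart_dom M i" and q: "q \<in> chart_dom N j"
    and f: "chart_differentiable M i f p" and h: "chart_differentiable N j h q"
    and F: "\<And>a b. a \<in> chart_dom M i \<Longrightarrow> b \<in> chart_dom N j \<Longrightarrow> F (a, b) = (f a, h b)"
  shows "chart_deriv (prod_atlas M N) (i, j) F (p, q) u =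
    (chart_deriv M i f p (fst u), chart_deriv N j h q (snd u))"
proof -
  have "has_chart_derivative (prod_atlas M N) (i, j) (\<lambda>z. (f (fst z), h (snd z))) (p, q)
      (\<lambda>u. (chart_deriv M i f p (fst u), chart_deriv N j h q (snd u)))"
    using has_chart_derivative_fst[OF p q chart_differentiableD[OF f]]
      has_chart_derivative_snd[OF p q chart_differentiableD[OF h]]
    unfolding has_chart_derivative_def by (rule has_derivative_Pair)
  then have "has_chart_derivative (prod_atlas M N) (i, j) F (p, q)
      (\<lambda>u. (chart_deriv M i f p (fst u), chart_deriv N j h q (snd u)))"
    by (rule has_chart_derivative_cong[rotated]) (auto simp: p q F)
  then show ?thesis
    by (simp add: chart_deriv_eqI)
qed

lemma smooth_in_chart_fst:
  assumes "smooth_in_chart M i f"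
  shows "smooth_in_chart (prod_atlas M N) (i, j) (\<lambda>z. f (fst z))"
  unfolding smooth_in_chart_def smooth_on_def
proof
  fix k
  have "C_on k (chart_img (prod_atlas M N) (i, j)) (\<lambda>x. f (chart_inv M i (fst x)))"
    using assms unfolding smooth_in_chart_def smooth_on_def
    by (intro C_on_bounded_linear_pullback[OF open_img bounded_linear_fst,
          where S = "chart_img M i" and f = "\<lambda>x. f (chart_inv M i x)"]) (auto simp: chart_img_prod)
  then show "C_on k (chart_img (prod_atlas M N) (i, j))
      (\<lambda>x. f (fst (chart_inv (prod_atlas M N) (i, j) x)))"
    by (rule C_on_cong[OF open_img]) (auto simp: chart_img_prod chart_inv_prod)
qed

lemma smooth_in_chart_snd:
  assumes "smooth_in_chart N j f"
  shows "smooth_in_chart (prod_atlas M N) (i, j) (\<lambda>z. f (snd z))"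
  unfolding smooth_in_chart_def smooth_on_def
proof
  fix k
  have "C_on k (chart_img (prod_atlas M N) (i, j)) (\<lambda>x. f (chart_inv N j (snd x)))"
    using assms unfolding smooth_in_chart_def smooth_on_def
    by (intro C_on_bounded_linear_pullback[OF open_img bounded_linear_snd,
          where S = "chart_img N j" and f = "\<lambda>x. f (chart_inv N j x)"]) (auto simp: chart_img_prod)
  then show "C_on k (chart_img (prod_atlas M N) (i, j))
      (\<lambda>x. f (snd (chart_inv (prod_atlas M N) (i, j) x)))"
    by (rule C_on_cong[OF open_img]) (auto simp: chart_img_prod chart_inv_prod)
qed

end

locale riemannian_chart_product =
  A: riemannian_chart M i g + B: riemannian_chart N j h
  for M :: "('a, 'e::euclidean_space, 'i) atlas" and i and g
    and N :: "('b, 'f::euclidean_space, 'j) atlas" and j and h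
begin

sublocale chart_product M i N j ..

sublocale riemannian_chart "prod_atlas M N" "(i, j)" "metric_prod g h"
proof
  show "smooth_in_chart (prod_atlas M N) (i, j) (\<lambda>p. metric_prod g h (i, j) p u v)" for u v
    unfolding metric_prod_apply smooth_in_chart_def smooth_on_def
    using smooth_in_chart_fst[OF A.smooth_g] smooth_in_chart_snd[OF B.smooth_g]
    by (intro allI C_on_add open_img) (auto simp: smooth_in_chart_def smooth_on_def)
  show "inner_form (metric_prod g h (i, j) z)" if in_dom: "z \<in> chart_dom (prod_atlas M N) (i, j)" for z
  proof -
    obtain p q where z: "z = (p, q)" "p \<in> chart_dom M i" "q \<in> chart_dom N j"
      using in_dom by (cases z) auto
    have pos: "metric_prod g h (i, j) z u u > 0" if "u \<noteq> 0" for u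
    proof -
      have "g i p (fst u) (fst u) \<ge> 0" "h j q (snd u) (snd u) \<ge> 0"
        using A.inner_form_g[OF z(2)] B.inner_form_g[OF z(3)]
          linear_0[OF A.g_linear(1)[OF z(2)]] linear_0[OF B.g_linear(1)[OF z(3)]]
        unfolding inner_form_def by (metis less_eq_real_def)+
      moreover have "g i p (fst u) (fst u) > 0 \<or> h j q (snd u) (snd u) > 0"
        using A.inner_form_g[OF z(2)] B.inner_form_g[OF z(3)] that
        unfolding inner_form_def by (metis prod_eqI zero_prod_def fst_conv snd_conv)
      ultimately show ?thesis
        by (auto simp: metric_prod_apply z(1))
    qed
    have sym: "metric_prod g h (i, j) z u v = metric_prod g h (i, j) z v u" for u v
      using A.g_sym[OF z(2)] B.g_sym[OF z(3)] by (simp add: metric_prod_apply z(1))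
    have lin: "linear (\<lambda>u. metric_prod g h (i, j) z u v)" for v
      by (rule linearI)
         (simp_all add: metric_prod_apply z(1) algebra_simps
            linear_add[OF A.g_linear(2)[OF z(2)]] linear_add[OF B.g_linear(2)[OF z(3)]]
            linear_cmul[OF A.g_linear(2)[OF z(2)]] linear_cmul[OF B.g_linear(2)[OF z(3)]])
    have "linear (metric_prod g h (i, j) z v)" for v
      using lin[of v] by (subst (asm) sym)
    with lin sym pos show ?thesis
      by (auto simp: inner_form_def bilinear_def)
  qed
qed

context
  fixes p q
  assumes p: "p \<in> chart_dom M i" and q: "q \<in> chart_dom N j"
begin

lemma koszul_prod:
  "koszul (p, q) u v w =
     A.koszul p (fst u) (fst v) (fst w) + B.koszul q (snd u) (snd v) (snd w)"
proof -
  have "dg (p, q) x u v = A.dg p (fst x) (fst u) (fst v) + B.dg q (snd x) (snd u) (snd v)" for x u v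
  proof -
    have "has_chart_derivative (prod_atlas M N) (i, j) (\<lambda>z. metric_prod g h (i, j) z u v) (p, q)
        (\<lambda>x. A.dg p (fst x) (fst u) (fst v) + B.dg q (snd x) (snd u) (snd v))"
      unfolding metric_prod_apply
      by (intro has_chart_derivative_add has_chart_derivative_fst[OF p q]
          has_chart_derivative_snd[OF p q] chart_differentiableD A.g_differentiable[OF p]
          B.g_differentiable[OF q])
    then show ?thesis
      by (simp add: chart_deriv_eqI)
  qed
  then show ?thesis
    by (simp add: koszul_def A.koszul_def B.koszul_def field_simps)
qed

lemma christoffel_prod:
  "christoffel (prod_atlas M N) (metric_prod g h) (i, j) (p, q) u v =
     (christoffel M g i p (fst u) (fst v), christoffel N h j q (snd u) (snd v))"
  by (rule christoffel_eqI)
     (simp_all add: p q koszul_prod metric_prod_apply A.g_christoffel B.g_christoffel)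

end

text \<open>
  The curvature differentiates the Christoffel symbols, so their splitting is needed at all points
  near \<open>(p, q)\<close>; this is why the point is fixed anew.
\<close>

context
  fixes p q
  assumes p: "p \<in> chart_dom M i" and q: "q \<in> chart_dom N j"
begin

lemma curvature_prod:
  "curvature (prod_atlas M N) (metric_prod g h) (i, j) (p, q) u v w =
     (curvature M g i p (fst u) (fst v) (fst w), curvature N h j q (snd u) (snd v) (snd w))"
proof -
  have "D_christoffel (p, q) x u v =
      (A.D_christoffel p (fst x) (fst u) (fst v), B.D_christoffel q (snd x) (snd u) (snd v))" for x u v
    by (rule chart_deriv_Pair[OF p q A.christoffel_differentiable[OF p] B.christoffel_differentiable[OF q]])
       (simp add: christoffel_prod)
  then show ?thesis
    by (simp add: curvature_def christoffel_prod p q)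
qed

lemma ricci_prod:
  "ricci (prod_atlas M N) (metric_prod g h) (i, j) (p, q) v w =
     ricci M g i p (fst v) (fst w) + ricci N h j q (snd v) (snd w)"
  by (simp add: ricci_def endo_trace_def sum_Basis_prod curvature_prod sum.distrib)

text \<open>
  With \<open>J = \<mu> (m - n)\<close> the coefficients of \<open>g\<close> and \<open>h\<close> in \<open>Ric - J (g + h)\<close> are \<open>2 (m - 1) \<mu> - \<mu> (m - n)\<close>
  and \<open>- 2 (n - 1) \<mu> - \<mu> (m - n)\<close>, that is \<open>\<plusminus> \<mu> (m + n - 2)\<close>, and \<open>P\<close> is the quotient by \<open>m + n - 2\<close>.
\<close>

lemma schouten_prod_einstein:
  assumes g: "\<And>v w. ricci M g i p v w = 2 * (real DIM('e) - 1) * \<mu> * g i p v w"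
    and h: "\<And>v w. ricci N h j q v w = - (2 * (real DIM('f) - 1) * \<mu> * h j q v w)"
    and dim: "DIM('e) + DIM('f) \<ge> 3"
  shows "schouten (prod_atlas M N) (metric_prod g h) (i, j) (p, q) u v =
    \<mu> * (g i p (fst u) (fst v) - h j q (snd u) (snd v))"
proof -
  let ?m = "real DIM('e)" and ?n = "real DIM('f)"
  have "sharp (metric_prod g h (i, j) (p, q)) (ricci (prod_atlas M N) (metric_prod g h) (i, j) (p, q) u) =
      ((2 * (?m - 1) * \<mu>) *\<^sub>R fst u, (- (2 * (?n - 1) * \<mu>)) *\<^sub>R snd u)" for u
    by (intro sharp_eqI inner_form_g)
       (simp_all add: p q metric_prod_apply ricci_prod g h linear_cmul[OF A.g_linear(2)[OF p]]
          linear_neg[OF B.g_linear(2)[OF q]] linear_cmul[OF B.g_linear(2)[OF q]])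
  then have "scalar_curvature (prod_atlas M N) (metric_prod g h) (i, j) (p, q) =
      2 * (?m - 1) * \<mu> * ?m - 2 * (?n - 1) * \<mu> * ?n"
    by (simp add: scalar_curvature_def endo_trace_def sum_Basis_prod)
  also have "\<dots> = 2 * \<mu> * (?m - ?n) * (?m + ?n - 1)"
    by (simp add: algebra_simps)
  finally have scal: "scalar_curvature (prod_atlas M N) (metric_prod g h) (i, j) (p, q) =
      2 * \<mu> * (?m - ?n) * (?m + ?n - 1)" .
  have cancel: "2 * \<mu> * a * b / (2 * b) = \<mu> * a" if "b \<noteq> 0" for a b :: real
    using that by simp
  have Sc: "scalar_curvature (prod_atlas M N) (metric_prod g h) (i, j) (p, q) /
      (2 * (real DIM('e \<times> 'f) - 1)) = \<mu> * (?m - ?n)"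
    using cancel[of "?m + ?n - 1" "?m - ?n"] dim unfolding scal by simp
  have traceless: "ricci (prod_atlas M N) (metric_prod g h) (i, j) (p, q) u v -
      \<mu> * (?m - ?n) * metric_prod g h (i, j) (p, q) u v =
      \<mu> * (g i p (fst u) (fst v) - h j q (snd u) (snd v)) * (real DIM('e \<times> 'f) - 2)"
    by (simp add: ricci_prod g h metric_prod_apply algebra_simps)
  have "real DIM('e \<times> 'f) - 2 \<noteq> 0"
    using dim by simp
  then show ?thesis
    unfolding schouten_def Sc traceless by simp
qed

end

end

section \<open>Tractors of a product\<close>

lemma product_tractor_map_alt:
  "product_tractor_map x =
     (fst (fst x) + fst (snd x), (fst (snd (fst x)), fst (snd (snd x))),
      snd (snd (fst x)) + snd (snd (snd x)))"
  by (cases x rule: product_tractor_map.cases) simp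

lemma bounded_linear_product_tractor_map:
  "bounded_linear (product_tractor_map ::
     'e::euclidean_space tractor \<times> 'f::euclidean_space tractor \<Rightarrow> ('e \<times> 'f) tractor)"
  unfolding linear_conv_bounded_linear[symmetric]
  by (rule linearI) (simp_all add: product_tractor_map_alt algebra_simps)

text \<open>
  Pairing with \<open>I = (1, 0, - \<mu>)\<close> gives \<open>r - \<mu> s\<close>.
\<close>

lemma tractor_perp_iff:
  assumes "inner_form G"
  shows "(s, t, r) \<in> tractor_perp G \<mu> \<longleftrightarrow> r = \<mu> * s"
  using linear_0[OF inner_form_linear(1)[OF assms]]
  by (auto simp: tractor_perp_def einstein_tractor_def)

text \<open>
  The inverse solves \<open>s = s\<^sub>1 + s\<^sub>2\<close> and \<open>r = \<mu> (s\<^sub>1 - s\<^sub>2)\<close> for \<open>s\<^sub>1\<close> and \<open>s\<^sub>2\<close>.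
\<close>

lemma bij_betw_product_tractor_map:
  assumes G: "inner_form G" and H: "inner_form H" and "\<mu> \<noteq> 0"
  shows "bij_betw product_tractor_map (tractor_perp G \<mu> \<times> tractor_perp H (- \<mu>)) UNIV"
proof (rule bij_betw_byWitness[where f' = "\<lambda>(s, (t1, t2), r).
    (((s + r / \<mu>) / 2, t1, (\<mu> * s + r) / 2), ((s - r / \<mu>) / 2, t2, (r - \<mu> * s) / 2))"])
qed (use \<open>\<mu> \<noteq> 0\<close> in \<open>auto simp: tractor_perp_iff[OF G] tractor_perp_iff[OF H] field_simps\<close>)

text \<open>
  The cross terms \<open>s\<^sub>1 r\<^sub>2' + s\<^sub>2' r\<^sub>1\<close> and \<open>s\<^sub>2 r\<^sub>1' + s\<^sub>1' r\<^sub>2\<close> vanish, since \<open>r\<^sub>1 = \<mu> s\<^sub>1\<close> and \<open>r\<^sub>2 = - \<mu> s\<^sub>2\<close>.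
\<close>

lemma tractor_metric_product:
  assumes G: "inner_form (g i p)" and H: "inner_form (h j q)"
    and "v \<in> tractor_perp (g i p) \<mu> \<times> tractor_perp (h j q) (- \<mu>)"
    and "w \<in> tractor_perp (g i p) \<mu> \<times> tractor_perp (h j q) (- \<mu>)"
  shows "tractor_metric (metric_prod g h (i, j) (p, q)) (product_tractor_map v) (product_tractor_map w) =
    tractor_metric (g i p) (fst v) (fst w) + tractor_metric (h j q) (snd v) (snd w)"
  using assms(3,4)
  by (cases v rule: product_tractor_map.cases; cases w rule: product_tractor_map.cases)
     (simp add: tractor_perp_iff[OF G] tractor_perp_iff[OF H] metric_prod_apply algebra_simps)

text \<open>
  The top slots for \<open>\<mu>\<close> and \<open>- \<mu>\<close> are opposite and the bottom slots add up to \<open>1\<close>, which is why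
  the canonical tractors correspond.
\<close>

lemma perp_proj_canonical_tractor:
  assumes "inner_form G" "\<mu> \<noteq> 0"
  shows "perp_proj G \<mu> canonical_tractor = (1 / (2 * \<mu>), 0, 1 / 2)"
  using assms(2) linear_0[OF inner_form_linear(1)[OF assms(1)]]
  by (simp add: perp_proj_def canonical_tractor_def einstein_tractor_def)

text \<open>
  Coordinate changes of vectors are chart derivatives of another chart, so the rule for
  derivatives of pairs also covers the transition functions of a product.
\<close>

lemma vector_transition_eq: "vector_transition M i i' p = chart_deriv M i (chart_map M i') p"
  by (auto simp: vector_transition_def chart_deriv_def transition_def o_def)

lemma chart_map_differentiable:
  assumes "smooth_manifold M" "i \<in> charts M" "i' \<in> charts M" "p \<in> chart_dom M i \<inter> chart_dom M i'"
  shows "chart_differentiable M i (chart_map M i') p"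
proof -
  have "smooth_on (chart_map M i ` (chart_dom M i \<inter> chart_dom M i')) (transition M i i')"
    using assms(1-3) by (auto simp: smooth_manifold_def)
  from smooth_on_differentiable[OF this imageI[OF assms(4)]] show ?thesis
    by (simp add: chart_differentiable_def transition_def o_def)
qed

context riemannian_chart_product
begin

lemma vector_transition_prod:
  assumes "p \<in> chart_dom M i" "q \<in> chart_dom N j"
    and "chart_differentiable M i (chart_map M i') p" "chart_differentiable N j (chart_map N j') q"
  shows "vector_transition (prod_atlas M N) (i, j) (i', j') (p, q) u =
    (vector_transition M i i' p (fst u), vector_transition N j j' q (snd u))"
  unfolding vector_transition_eq by (rule chart_deriv_Pair[OF assms]) simp

lemma tractor_transition_prod:
  assumes "p \<in> chart_dom M i" "q \<in> chart_dom N j"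
    and "chart_differentiable M i (chart_map M i') p" "chart_differentiable N j (chart_map N j') q"
  shows "tractor_transition (prod_atlas M N) (i, j) (i', j') (p, q) (product_tractor_map (v, w)) =
    product_tractor_map (tractor_transition M i i' p v, tractor_transition N j j' q w)"
  by (cases v, cases w) (simp add: vector_transition_prod[OF assms])

text \<open>
  The algebraic part of the two connections: \<open>P\<close> acts as \<open>\<mu>\<close> on the first factor and as \<open>- \<mu>\<close> on
  the second, and the relations \<open>r\<^sub>1 = \<mu> s\<^sub>1\<close>, \<open>r\<^sub>2 = - \<mu> s\<^sub>2\<close> remove the slots of the other factor from the
  coefficients of \<open>u\<^sub>1\<close> and \<open>u\<^sub>2\<close>.
\<close>

lemma normal_form_prod:
  assumes p: "p \<in> chart_dom M i" and q: "q \<in> chart_dom N j"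
    and schouten: "\<And>u v. schouten (prod_atlas M N) (metric_prod g h) (i, j) (p, q) u v =
      \<mu> * (g i p (fst u) (fst v) - h j q (snd u) (snd v))"
    and v: "v \<in> tractor_perp (g i p) \<mu>" and w: "w \<in> tractor_perp (h j q) (- \<mu>)"
  shows "normal_form (prod_atlas M N) (metric_prod g h) (i, j) (p, q) u (product_tractor_map (v, w)) =
    product_tractor_map
      (einstein_form M g \<mu> i p (fst u) v, einstein_form N h (- \<mu>) j q (snd u) w)"
proof -
  obtain s1 t1 s2 t2 where vw: "v = (s1, t1, \<mu> * s1)" "w = (s2, t2, - \<mu> * s2)"
    using v w tractor_perp_iff[OF A.inner_form_g[OF p]] tractor_perp_iff[OF B.inner_form_g[OF q]]
    by (metis prod_cases3)
  have "sharp (metric_prod g h (i, j) (p, q))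
      (schouten (prod_atlas M N) (metric_prod g h) (i, j) (p, q) u) = (\<mu> *\<^sub>R fst u, (- \<mu>) *\<^sub>R snd u)"
    by (intro sharp_eqI inner_form_g)
       (simp_all add: p q metric_prod_apply schouten linear_cmul[OF A.g_linear(2)[OF p]]
          linear_neg[OF B.g_linear(2)[OF q]] linear_cmul[OF B.g_linear(2)[OF q]] algebra_simps)
  then show ?thesis
    by (cases u) (simp add: vw schouten metric_prod_apply christoffel_prod[OF p q] algebra_simps,
      simp flip: scaleR_left_distrib)
qed

end

lemma special_einstein_product_scales:
  assumes "special_einstein_product M1 g1 \<mu>1 M2 g2 \<mu>2"
  shows "\<mu>2 = - \<mu>1" "\<mu>1 \<noteq> 0"
proof -
  have man: "smooth_manifold M1" "riemannian_metric M1 g1" "smooth_manifold M2" "riemannian_metric M2 g2"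
    using assms by (auto simp: special_einstein_product_def einstein_manifold_def)
  obtain i p j q where ij: "i \<in> charts M1" "p \<in> chart_dom M1 i" "j \<in> charts M2" "q \<in> chart_dom M2 j"
    using man(1,3) unfolding smooth_manifold_def by (metis UNIV_I UN_iff)
  interpret A: riemannian_chart M1 i g1
    by (rule riemannian_chart_of_metric[OF man(1,2) ij(1)])
  interpret B: riemannian_chart M2 j g2
    by (rule riemannian_chart_of_metric[OF man(3,4) ij(3)])
  have "tractor_metric (g1 i p) (einstein_tractor \<mu>1) (einstein_tractor \<mu>1) = - 2 * \<mu>1"
    "tractor_metric (g2 j q) (einstein_tractor \<mu>2) (einstein_tractor \<mu>2) = - 2 * \<mu>2"
    using linear_0[OF A.g_linear(1)[OF ij(2)]] linear_0[OF B.g_linear(1)[OF ij(4)]]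
    by (simp_all add: einstein_tractor_def)
  then show "\<mu>2 = - \<mu>1" "\<mu>1 \<noteq> 0"
    using assms ij unfolding special_einstein_product_def by force+
qed

text \<open>
  The differential part of the connection passes through \<open>product_tractor_map\<close> because
  this map is linear with coefficients that do not depend on the point, so only the algebraic
  parts have to be compared.
\<close>

proposition product_tractor_identification_special:
  fixes M1 :: "('a::{second_countable_topology, t2_space}, 'e::euclidean_space, 'i) atlas"
    and M2 :: "('b::{second_countable_topology, t2_space}, 'f::euclidean_space, 'j) atlas"
  assumes S: "special_einstein_product M1 g1 \<mu>1 M2 g2 \<mu>2"
  shows "product_tractor_identification M1 g1 \<mu>1 M2 g2 \<mu>2 (\<lambda>k z. product_tractor_map)"
proof -
  note \<mu> = special_einstein_product_scales[OF S]
  have E1: "einstein_manifold M1 g1 \<mu>1" and E2: "einstein_manifold M2 g2 \<mu>2"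
    and dim: "DIM('e) + DIM('f) \<ge> 3"
    using S by (auto simp: special_einstein_product_def)
  then have man: "smooth_manifold M1" "riemannian_metric M1 g1" "smooth_manifold M2" "riemannian_metric M2 g2"
    by (auto simp: einstein_manifold_def)
  have chart_prod: "riemannian_chart_product M1 i g1 M2 j g2" if "i \<in> charts M1" "j \<in> charts M2" for i j
    by (intro riemannian_chart_product.intro riemannian_chart_of_metric man that)
  interpret L: bounded_linear "product_tractor_map :: 'e tractor \<times> 'f tractor \<Rightarrow> ('e \<times> 'f) tractor"
    by (rule bounded_linear_product_tractor_map)
  have fibre: "let F = product_tractor_map;
          E = tractor_perp (g1 i p) \<mu>1 \<times> tractor_perp (g2 j q) \<mu>2
      in bij_betw F E UNIV \<and>
         (\<forall>v\<in>E. \<forall>w\<in>E. F (v + w) = F v + F w) \<and>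
         (\<forall>c. \<forall>v\<in>E. F (c *\<^sub>R v) = c *\<^sub>R F v) \<and>
         (\<forall>v\<in>E. \<forall>w\<in>E.
            tractor_metric (metric_prod g1 g2 (i, j) (p, q)) (F v) (F w) =
              tractor_metric (g1 i p) (fst v) (fst w) + tractor_metric (g2 j q) (snd v) (snd w)) \<and>
         F (perp_proj (g1 i p) \<mu>1 canonical_tractor, perp_proj (g2 j q) \<mu>2 canonical_tractor)
           = canonical_tractor"
    if "i \<in> charts M1" "j \<in> charts M2" "p \<in> chart_dom M1 i" "q \<in> chart_dom M2 j" for i j p q
  proof -
    interpret riemannian_chart_product M1 i g1 M2 j g2
      by (rule chart_prod[OF that(1,2)])
    note forms = A.inner_form_g[OF that(3)] B.inner_form_g[OF that(4)]
    have "product_tractor_map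
        (perp_proj (g1 i p) \<mu>1 canonical_tractor, perp_proj (g2 j q) \<mu>2 canonical_tractor)
          = canonical_tractor"
      using \<mu> by (simp add: perp_proj_canonical_tractor forms) (simp add: canonical_tractor_def zero_prod_def)
    then show ?thesis
      using bij_betw_product_tractor_map[OF forms \<mu>(2)] tractor_metric_product[where g = g1 and h = g2, OF forms, of _ \<mu>1]
      unfolding Let_def \<mu>(1) by (intro conjI ballI allI L.add L.scaleR) auto
  qed
  moreover
  {
    fix W :: "('a, 'e, 'i, 'b, 'f, 'j) sum_section"
    assume field: "perp_sum_field M1 g1 \<mu>1 M2 g2 \<mu>2 W"
    have smooth: "smooth_in_chart (prod_atlas M1 M2) (i, j) (W (i, j))"
      if "i \<in> charts M1" "j \<in> charts M2" for i j
      using field that by (simp add: perp_sum_field_def)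
    have perp: "W (i, j) (p, q) \<in> tractor_perp (g1 i p) \<mu>1 \<times> tractor_perp (g2 j q) \<mu>2"
      if "i \<in> charts M1" "j \<in> charts M2" "p \<in> chart_dom M1 i" "q \<in> chart_dom M2 j" for i j p q
      using field that unfolding perp_sum_field_def by blast
    have trans: "W (i', j') (p, q) =
        (tractor_transition M1 i i' p (fst (W (i, j) (p, q))),
         tractor_transition M2 j j' q (snd (W (i, j) (p, q))))"
      if "i \<in> charts M1" "i' \<in> charts M1" "j \<in> charts M2" "j' \<in> charts M2"
        "p \<in> chart_dom M1 i \<inter> chart_dom M1 i'" "q \<in> chart_dom M2 j \<inter> chart_dom M2 j'"
      for i i' j j' p q
      using field that unfolding perp_sum_field_def by blast
    have "tractor_field (prod_atlas M1 M2) (\<lambda>k z. product_tractor_map (W k z))"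
      unfolding tractor_field_def
    proof (intro conjI ballI)
      fix k assume "k \<in> charts (prod_atlas M1 M2)"
      then obtain i j where k: "k = (i, j)" "i \<in> charts M1" "j \<in> charts M2"
        by auto
      interpret riemannian_chart_product M1 i g1 M2 j g2
        by (rule chart_prod[OF k(2,3)])
      show "smooth_in_chart (prod_atlas M1 M2) k (\<lambda>z. product_tractor_map (W k z))"
        unfolding k(1)
        by (rule smooth_in_chart_linear_image[OF bounded_linear_product_tractor_map smooth[OF k(2,3)]])
    next
      fix k k' z
      assume "k \<in> charts (prod_atlas M1 M2)" "k' \<in> charts (prod_atlas M1 M2)"
        and "z \<in> chart_dom (prod_atlas M1 M2) k \<inter> chart_dom (prod_atlas M1 M2) k'"
      then obtain i j i' j' p q where k: "k = (i, j)" "i \<in> charts M1" "j \<in> charts M2"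
          "k' = (i', j')" "i' \<in> charts M1" "j' \<in> charts M2"
        and z: "z = (p, q)" "p \<in> chart_dom M1 i \<inter> chart_dom M1 i'" "q \<in> chart_dom M2 j \<inter> chart_dom M2 j'"
        by auto
      interpret riemannian_chart_product M1 i g1 M2 j g2
        by (rule chart_prod[OF k(2,3)])
      have "tractor_transition (prod_atlas M1 M2) k k' z
          (product_tractor_map (fst (W (i, j) (p, q)), snd (W (i, j) (p, q)))) =
          product_tractor_map (W k' z)"
        unfolding k(1,4) z(1) trans[OF k(2,5,3,6) z(2,3)]
        using z by (intro tractor_transition_prod chart_map_differentiable man k) auto
      then show "product_tractor_map (W k' z) =
          tractor_transition (prod_atlas M1 M2) k k' z (product_tractor_map (W k z))"
        by (simp add: k z)
    qed
    moreover have "normal_tractor_connection (prod_atlas M1 M2) (metric_prod g1 g2)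
        (\<lambda>k z. product_tractor_map (W k z)) k z u =
        product_tractor_map (perp_sum_connection M1 g1 \<mu>1 M2 g2 \<mu>2 W k z u)"
      if in_dom: "k \<in> charts (prod_atlas M1 M2)" "z \<in> chart_dom (prod_atlas M1 M2) k" for k z u
    proof -
      obtain i j p q where k: "k = (i, j)" "i \<in> charts M1" "j \<in> charts M2"
        and z: "z = (p, q)" and p: "p \<in> chart_dom M1 i" and q: "q \<in> chart_dom M2 j"
        using in_dom by (cases k; cases z) auto
      interpret riemannian_chart_product M1 i g1 M2 j g2
        by (rule chart_prod[OF k(2,3)])
      obtain u1 u2 where u: "u = (u1, u2)" by (cases u)
      obtain v w where vw: "W (i, j) (p, q) = (v, w)" by (cases "W (i, j) (p, q)")
      have mem: "v \<in> tractor_perp (g1 i p) \<mu>1" "w \<in> tractor_perp (g2 j q) (- \<mu>1)"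
        using perp[OF k(2,3) p q] vw \<mu>(1) by auto
      have "chart_deriv (prod_atlas M1 M2) (i, j) (\<lambda>z. product_tractor_map (W (i, j) z)) (p, q) u =
          product_tractor_map (chart_deriv (prod_atlas M1 M2) (i, j) (W (i, j)) (p, q) u)"
        using p q
        by (intro chart_deriv_linear bounded_linear_product_tractor_map
            smooth_chart_differentiable smooth k) simp
      moreover have "normal_form (prod_atlas M1 M2) (metric_prod g1 g2) (i, j) (p, q) u
          (product_tractor_map (v, w)) =
          product_tractor_map (einstein_form M1 g1 \<mu>1 i p u1 v, einstein_form M2 g2 \<mu>2 j q u2 w)"
      proof -
        have "ricci M1 g1 i p a b = 2 * (real DIM('e) - 1) * \<mu>1 * g1 i p a b" for a b
          by (rule einstein_manifold_ricci[OF E1 k(2) p])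
        moreover have "ricci M2 g2 j q a b = - (2 * (real DIM('f) - 1) * \<mu>1 * g2 j q a b)" for a b
          using einstein_manifold_ricci[OF E2 k(3) q] by (simp add: \<mu>(1))
        ultimately show ?thesis
          using normal_form_prod[OF p q schouten_prod_einstein[OF p q _ _ dim] mem] by (simp add: u \<mu>(1))
      qed
      ultimately show ?thesis
        by (simp add: normal_tractor_connection_def perp_sum_connection_def k z u vw L.add[symmetric])
    qed
    ultimately have "tractor_field (prod_atlas M1 M2) (\<lambda>k z. product_tractor_map (W k z)) \<and>
        (\<forall>k\<in>charts (prod_atlas M1 M2). \<forall>z\<in>chart_dom (prod_atlas M1 M2) k. \<forall>u.
           normal_tractor_connection (prod_atlas M1 M2) (metric_prod g1 g2)
               (\<lambda>k z. product_tractor_map (W k z)) k z u =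
             product_tractor_map (perp_sum_connection M1 g1 \<mu>1 M2 g2 \<mu>2 W k z u))"
      by blast
  }
  ultimately show ?thesis
    unfolding product_tractor_identification_def by blast
qed


section \<open>Parallel tractors of a factor\<close>

lemma tractor_transition_zero:
  assumes "chart_differentiable M i (chart_map M i') p"
  shows "tractor_transition M i i' p 0 = 0"
  using linear_0[OF linear_chart_deriv[OF assms]]
  by (simp add: zero_prod_def vector_transition_eq)

lemma perp_sum_field_sum_inl:
  fixes M1 :: "('a::{second_countable_topology, t2_space}, 'e::euclidean_space, 'i) atlas"
    and M2 :: "('b::{second_countable_topology, t2_space}, 'f::euclidean_space, 'j) atlas"
  assumes M: "smooth_manifold M1" "riemannian_metric M1 g1"
      "smooth_manifold M2" "riemannian_metric M2 g2"
    and K: "tractor_field M1 K" "perp_valued M1 g1 \<mu>1 K"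
  shows "perp_sum_field M1 g1 \<mu>1 M2 g2 \<mu>2 (sum_inl K)"
  unfolding perp_sum_field_def
proof (intro conjI ballI)
  fix k assume "k \<in> charts (prod_atlas M1 M2)"
  then obtain i j where k: "k = (i, j)" "i \<in> charts M1" "j \<in> charts M2"
    by auto
  interpret riemannian_chart_product M1 i g1 M2 j g2
    by (intro riemannian_chart_product.intro riemannian_chart_of_metric M k)
  have "smooth_in_chart M1 i (K i)"
    using K(1) k by (simp add: tractor_field_def)
  from smooth_in_chart_linear_image[OF
      bounded_linear_Pair[OF bounded_linear_ident bounded_linear_zero] smooth_in_chart_fst[OF this]]
  show "smooth_in_chart (prod_atlas M1 M2) k (sum_inl K k)"
    by (simp add: k sum_inl_def case_prod_unfold)
next
  fix i j p q
  assume ij: "i \<in> charts M1" "j \<in> charts M2" "p \<in> chart_dom M1 i" "q \<in> chart_dom M2 j"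
  interpret riemannian_chart M2 j g2
    by (rule riemannian_chart_of_metric[OF M(3,4) ij(2)])
  have "(0 :: 'f tractor) \<in> tractor_perp (g2 j q) \<mu>2"
    using tractor_perp_iff[OF inner_form_g[OF ij(4)]] by (simp add: zero_prod_def)
  then show "sum_inl K (i, j) (p, q) \<in> tractor_perp (g1 i p) \<mu>1 \<times> tractor_perp (g2 j q) \<mu>2"
    using K(2) ij by (simp add: sum_inl_def perp_valued_def)
next
  fix i i' j j' p q
  assume i: "i \<in> charts M1" "i' \<in> charts M1" and j: "j \<in> charts M2" "j' \<in> charts M2"
    and p: "p \<in> chart_dom M1 i \<inter> chart_dom M1 i'" and q: "q \<in> chart_dom M2 j \<inter> chart_dom M2 j'"
  have "K i' p = tractor_transition M1 i i' p (K i p)"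
    using K(1) i p unfolding tractor_field_def by blast
  then show "sum_inl K (i', j') (p, q) =
      (tractor_transition M1 i i' p (fst (sum_inl K (i, j) (p, q))),
       tractor_transition M2 j j' q (snd (sum_inl K (i, j) (p, q))))"
    using tractor_transition_zero[OF chart_map_differentiable[OF M(3) j q]]
    by (simp add: sum_inl_def)
qed

lemma perp_sum_connection_sum_inl:
  fixes M1 :: "('a::{second_countable_topology, t2_space}, 'e::euclidean_space, 'i) atlas"
    and M2 :: "('b::{second_countable_topology, t2_space}, 'f::euclidean_space, 'j) atlas"
  assumes M: "smooth_manifold M1" "riemannian_metric M1 g1"
      "smooth_manifold M2" "riemannian_metric M2 g2"
    and K: "tractor_field M1 K"
    and ij: "i \<in> charts M1" "j \<in> charts M2" and p: "p \<in> chart_dom M1 i" and q: "q \<in> chart_dom M2 j"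
  shows "perp_sum_connection M1 g1 \<mu>1 M2 g2 \<mu>2 (sum_inl K) (i, j) (p, q) u =
    (einstein_tractor_connection M1 g1 \<mu>1 K i p (fst u), 0)"
proof -
  interpret riemannian_chart_product M1 i g1 M2 j g2
    by (intro riemannian_chart_product.intro riemannian_chart_of_metric M ij)
  have "smooth_in_chart M1 i (K i)"
    using K ij by (simp add: tractor_field_def)
  then have "chart_differentiable M1 i (K i) p"
    by (rule A.smooth_chart_differentiable[OF _ p])
  moreover have "chart_differentiable M2 j (\<lambda>_. 0 :: 'f tractor) q"
    by (simp add: chart_differentiable_def)
  ultimately have "chart_deriv (prod_atlas M1 M2) (i, j) (sum_inl K (i, j)) (p, q) u =
      (chart_deriv M1 i (K i) p (fst u), chart_deriv M2 j (\<lambda>_. 0 :: 'f tractor) q (snd u))"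
    by (rule chart_deriv_Pair[OF p q]) (simp add: sum_inl_def)
  moreover have "einstein_form M2 g2 \<mu>2 j q (snd u) 0 = 0"
    using linear_0[OF B.g_linear(1)[OF q]] linear_0[OF B.christoffel_linear(1)[OF q]]
    by (simp add: zero_prod_def)
  ultimately show ?thesis
    by (simp add: perp_sum_connection_def einstein_tractor_connection_def sum_inl_def
        chart_deriv_const case_prod_unfold)
qed

lemma nonzero_section_of_independent:
  assumes "independent_sections M r K" "k \<in> {1..r}"
  shows "nonzero_section M (K k)"
proof (rule ccontr)
  assume zero: "\<not> nonzero_section M (K k)"
  define c :: "nat \<Rightarrow> real" where "c l = of_bool (l = k)" for l
  have "\<forall>i\<in>charts M. \<forall>p\<in>chart_dom M i. (\<Sum>l\<in>{1..r}. c l *\<^sub>R K l i p) = 0"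
    using zero by (intro ballI sum.neutral) (auto simp: c_def nonzero_section_def)
  then have "c k = 0"
    using assms unfolding independent_sections_def by blast
  then show False by (simp add: c_def)
qed

lemma product_tractor_map_inl: "product_tractor_map (v, 0) = (fst v, (fst (snd v), 0), snd (snd v))"
  for v :: "'e::euclidean_space tractor"
  by (simp add: product_tractor_map_alt)

lemma nonzero_induced_tractor:
  fixes K :: "('a, 'e::euclidean_space, 'i) tractor_section"
    and N :: "('b, 'f::euclidean_space, 'j) atlas"
  assumes "nonzero_section M K" "j \<in> charts N" "q \<in> chart_dom N j"
  shows "nonzero_section (prod_atlas M N) (induced_tractor K)"
proof -
  obtain i p where ip: "i \<in> charts M" "p \<in> chart_dom M i" "K i p \<noteq> 0"
    using assms(1) by (auto simp: nonzero_section_def)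
  then have "induced_tractor K (i, j) (p, q) \<noteq> 0"
    by (cases "K i p") (auto simp: induced_tractor_def sum_inl_def product_tractor_map_inl zero_prod_def)
  then show ?thesis
    unfolding nonzero_section_def using ip assms(2,3) by force
qed

lemma scale_singularity_set_eq:
  assumes "smooth_manifold M" "riemannian_metric M g"
  shows "scale_singularity_set M g K = {p. \<forall>i\<in>charts M. p \<in> chart_dom M i \<longrightarrow> fst (K i p) = 0}"
proof -
  have "tractor_metric (g i p) canonical_tractor (K i p) = fst (K i p)"
    if "i \<in> charts M" "p \<in> chart_dom M i" for i p
  proof -
    interpret riemannian_chart M i g
      by (rule riemannian_chart_of_metric[OF assms that(1)])
    show ?thesis
      using linear_0[OF g_linear(2)[OF that(2)]]
      by (cases "K i p") (simp add: canonical_tractor_def)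
  qed
  then show ?thesis
    by (auto simp: scale_singularity_set_def)
qed

lemma scale_singularity_set_induced_tractor:
  fixes M1 :: "('a::{second_countable_topology, t2_space}, 'e::euclidean_space, 'i) atlas"
    and M2 :: "('b::{second_countable_topology, t2_space}, 'f::euclidean_space, 'j) atlas"
  assumes M: "smooth_manifold M1" "riemannian_metric M1 g1"
      "smooth_manifold M2" "riemannian_metric M2 g2"
  shows "scale_singularity_set (prod_atlas M1 M2) (metric_prod g1 g2) (induced_tractor K) =
    scale_singularity_set M1 g1 K \<times> UNIV"
proof -
  have first_slot: "tractor_metric (metric_prod g1 g2 (i, j) (p, q)) canonical_tractor
      (induced_tractor K (i, j) (p, q)) = fst (K i p)"
    if "i \<in> charts M1" "j \<in> charts M2" "p \<in> chart_dom M1 i" "q \<in> chart_dom M2 j" for i j p q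
  proof -
    interpret riemannian_chart_product M1 i g1 M2 j g2
      by (intro riemannian_chart_product.intro riemannian_chart_of_metric M that)
    have "metric_prod g1 g2 (i, j) (p, q) 0 v = 0" for v
      using that linear_0[OF g_linear(2)] by simp
    then show ?thesis
      by (simp add: canonical_tractor_def induced_tractor_def sum_inl_def product_tractor_map_inl)
  qed
  have cover: "\<exists>j\<in>charts M2. q \<in> chart_dom M2 j" for q
    using M(3) unfolding smooth_manifold_def by (metis UNIV_I UN_iff)
  show ?thesis
    unfolding scale_singularity_set_eq[OF M(1,2)]
    using cover by (force simp: scale_singularity_set_def first_slot)
qed

theorem corollary3p2:
  fixes M1 :: "('a::{second_countable_topology, t2_space}, 'e::euclidean_space, 'i) atlas"
    and g1 :: "('a, 'e, 'i) metric" and \<mu>1 :: real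
    and M2 :: "('b::{second_countable_topology, t2_space}, 'f::euclidean_space, 'j) atlas"
    and g2 :: "('b, 'f, 'j) metric" and \<mu>2 :: real
    and r :: nat and K :: "nat \<Rightarrow> ('a, 'e, 'i) tractor_section"
  assumes "special_einstein_product M1 g1 \<mu>1 M2 g2 \<mu>2"
    and "\<And>k. k \<in> {1..r} \<Longrightarrow> parallel_tractor M1 g1 \<mu>1 (K k)"
    and "\<And>k. k \<in> {1..r} \<Longrightarrow> perp_valued M1 g1 \<mu>1 (K k)"
    and "independent_sections M1 r K"
  shows "product_tractor_identification M1 g1 \<mu>1 M2 g2 \<mu>2 (\<lambda>k z. product_tractor_map) \<and>
    (\<forall>k\<in>{1..r}.
       almost_einstein_structure (prod_atlas M1 M2) (metric_prod g1 g2) (induced_tractor (K k)) \<and>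
       scale_singularity_set (prod_atlas M1 M2) (metric_prod g1 g2) (induced_tractor (K k))
         = scale_singularity_set M1 g1 (K k) \<times> UNIV)"
proof (intro conjI ballI)
  show ident: "product_tractor_identification M1 g1 \<mu>1 M2 g2 \<mu>2 (\<lambda>k z. product_tractor_map)"
    by (rule product_tractor_identification_special[OF assms(1)])
  have M: "smooth_manifold M1" "riemannian_metric M1 g1" "smooth_manifold M2" "riemannian_metric M2 g2"
    using assms(1) by (auto simp: special_einstein_product_def einstein_manifold_def)
  fix k assume k: "k \<in> {1..r}"
  then have K: "tractor_field M1 (K k)"
      "\<And>i p u. i \<in> charts M1 \<Longrightarrow> p \<in> chart_dom M1 i \<Longrightarrow>
        einstein_tractor_connection M1 g1 \<mu>1 (K k) i p u = 0"
    using assms(2) by (auto simp: parallel_tractor_def)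
  have field: "perp_sum_field M1 g1 \<mu>1 M2 g2 \<mu>2 (sum_inl (K k))"
    by (rule perp_sum_field_sum_inl[OF M K(1) assms(3)[OF k]])
  show "almost_einstein_structure (prod_atlas M1 M2) (metric_prod g1 g2) (induced_tractor (K k))"
    unfolding almost_einstein_structure_def
  proof (intro conjI ballI allI)
    show "tractor_field (prod_atlas M1 M2) (induced_tractor (K k))"
      using ident field unfolding product_tractor_identification_def induced_tractor_def by blast
    obtain j q where "j \<in> charts M2" "q \<in> chart_dom M2 j"
      using M(3) unfolding smooth_manifold_def by (metis UNIV_I UN_iff)
    then show "nonzero_section (prod_atlas M1 M2) (induced_tractor (K k))"
      by (rule nonzero_induced_tractor[OF nonzero_section_of_independent[OF assms(4) k]])
    fix l z u
    assume lz: "l \<in> charts (prod_atlas M1 M2)" "z \<in> chart_dom (prod_atlas M1 M2) l"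
    then obtain i j p q where ij: "l = (i, j)" "z = (p, q)" "i \<in> charts M1" "j \<in> charts M2"
      "p \<in> chart_dom M1 i" "q \<in> chart_dom M2 j"
      by (cases l; cases z) auto
    have "normal_tractor_connection (prod_atlas M1 M2) (metric_prod g1 g2) (induced_tractor (K k)) l z u =
        product_tractor_map (perp_sum_connection M1 g1 \<mu>1 M2 g2 \<mu>2 (sum_inl (K k)) l z u)"
      using ident field lz unfolding product_tractor_identification_def induced_tractor_def by blast
    also have "perp_sum_connection M1 g1 \<mu>1 M2 g2 \<mu>2 (sum_inl (K k)) l z u = (0, 0)"
      unfolding ij(1,2) perp_sum_connection_sum_inl[OF M K(1) ij(3-6)] by (simp add: K(2) ij)
    finally show "normal_tractor_connection (prod_atlas M1 M2) (metric_prod g1 g2)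
        (induced_tractor (K k)) l z u = 0"
      by (simp add: product_tractor_map_inl zero_prod_def)
  qed
  show "scale_singularity_set (prod_atlas M1 M2) (metric_prod g1 g2) (induced_tractor (K k)) =
      scale_singularity_set M1 g1 (K k) \<times> UNIV"
    by (rule scale_singularity_set_induced_tractor[OF M])
qed

end
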